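(* Let $A$ be a PAJ generated by a set $X$ of primitive axes and let $a\in X$. (i) There is a set $X'$ of primitive axes generating $A$, and a Frobenius form $(\cdot,\cdot)$ on $A$ for which $(x,x)=1$ for all $x\in X'$. (ii) One of the following holds: (1) $X'$ in (i) can be chosen so that $a\in X'$; or (2) $a$ is of type $-1$, there exists a primitive axis $b\in A$ of type $2$ with $ab\neq0$, and $a$ is in the radical of any Frobenius form on $A$.
   Context: Algebras are not necessarily associative, commutative or unital. $\mathbb F$ is a field of characteristic $\ne 2$ and $A$ is an $\mathbb F$-algebra. For an idempotent $a\in A$ put $A_0(a)=\{y\in A: ay=ya=0\}$ and $A_{\lambda,\delta}(a)=\{y\in A: ay=\lambda y,\ ya=\delta y\}$. For $\lambda,\delta\in\mathbb F\setminus\{0,1\}$, a primitive axis of type $(\lambda,\delta)$ is a nonzero idempotent $a\in A$ with $\{y:ay=y\}=\mathbb Fa=\{y:ya=y\}$, such that $A=\mathbb Fa\oplus A_0(a)\oplus A_{\lambda,\delta}(a)$ and this is a $\mathbb Z_2$-grading with even part $\mathbb Fa\oplus A_0(a)$ and odd part $A_{\lambda,\delta}(a)$. If $\lambda=\delta$ the type is called commutative and is also denoted $\lambda$; if $\lambda\neq\delta$ it is called noncommutative, and then $\lambda+\delta=1$ (a known fact, taken as a convention). Each primitive axis is regarded as carrying exactly one type (if $A_{\lambda,\delta}(a)=0$, a fixed choice is made). A PAJ is an algebra generated by a set of primitive axes (possibly of different types). A Frobenius form on $A$ is a nonzero bilinear form $(\cdot,\cdot):A\times A\to\mathbb F$ with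 $(x,yz)=(xy,z)$ for all $x,y,z\in A$. Its radical is $\{u\in A:(u,v)=0\ \text{for all } v\in A\}$. *)

theory Defs
  imports Complex_Main
begin

locale nonassoc_algebra = vector_space scale
  for scale :: "'f::field \<Rightarrow> 'a::ab_group_add \<Rightarrow> 'a" (infixr \<open>*s\<close> 75) +
  fixes mult :: "'a \<Rightarrow> 'a \<Rightarrow> 'a" (infixl \<open>\<star>\<close> 70)
  assumes linear_mult_right: "Vector_Spaces.linear scale scale (\<lambda>y. x \<star> y)"
    and linear_mult_left: "Vector_Spaces.linear scale scale (\<lambda>x. x \<star> y)"
begin

definition subalgebra :: "'a set \<Rightarrow> bool" where
  "subalgebra S \<longleftrightarrow> subspace S \<and> (\<forall>x\<in>S. \<forall>y\<in>S. x \<star> y \<in> S)"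

definition generates :: "'a set \<Rightarrow> bool" where
  "generates X \<longleftrightarrow> subalgebra hull X = UNIV"

definition null_part :: "'a \<Rightarrow> 'a set" where
  "null_part a = {y. a \<star> y = 0 \<and> y \<star> a = 0}"

definition eigen_part :: "'f \<Rightarrow> 'f \<Rightarrow> 'a \<Rightarrow> 'a set" where
  "eigen_part l d a = {y. a \<star> y = l *s y \<and> y \<star> a = d *s y}"

definition Z2_grading :: "'a set \<Rightarrow> 'a set \<Rightarrow> bool" where
  "Z2_grading E D \<longleftrightarrow> subspace E \<and> subspace D \<and>
     bij_betw (\<lambda>(x, y). x + y) (E \<times> D) UNIV \<and>
     (\<forall>x\<in>E. \<forall>y\<in>E. x \<star> y \<in> E) \<and> (\<forall>x\<in>E. \<forall>y\<in>D. x \<star> y \<in> D) \<and>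
     (\<forall>x\<in>D. \<forall>y\<in>E. x \<star> y \<in> D) \<and> (\<forall>x\<in>D. \<forall>y\<in>D. x \<star> y \<in> E)"

text \<open>The condition \<open>l \<noteq> d \<longrightarrow> l + d = 1\<close> is the usual convention on noncommutative types.
  The bijection says that the algebra is the internal direct sum of the three parts.\<close>

definition primitive_axis :: "'f \<Rightarrow> 'f \<Rightarrow> 'a \<Rightarrow> bool" where
  "primitive_axis l d a \<longleftrightarrow>
     l \<notin> {0, 1} \<and> d \<notin> {0, 1} \<and> (l \<noteq> d \<longrightarrow> l + d = 1) \<and>
     a \<noteq> 0 \<and> a \<star> a = a \<and>
     {y. a \<star> y = y} = span {a} \<and> {y. y \<star> a = y} = span {a} \<and>
     bij_betw (\<lambda>(u, y, z). u + y + z) (span {a} \<times> null_part a \<times> eigen_part l d a) UNIV \<and>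
     Z2_grading {u + y | u y. u \<in> span {a} \<and> y \<in> null_part a} (eigen_part l d a)"

definition primitive_axes :: "'a set" where
  "primitive_axes = {a. \<exists>l d. primitive_axis l d a}"

text \<open>If \<open>eigen_part l d a = {0}\<close>, then \<open>a\<close> is a primitive axis for several pairs
  \<open>(l, d)\<close>. A type function selects one of them for each primitive axis; its values elsewhere
  are irrelevant.\<close>

definition type_function :: "('a \<Rightarrow> 'f \<times> 'f) \<Rightarrow> bool" where
  "type_function \<tau> \<longleftrightarrow>
     (\<forall>a\<in>primitive_axes. primitive_axis (fst (\<tau> a)) (snd (\<tau> a)) a)"

definition frobenius_form :: "('a \<Rightarrow> 'a \<Rightarrow> 'f) \<Rightarrow> bool" where
  "frobenius_form B \<longleftrightarrow>
     (\<forall>x. Vector_Spaces.linear scale (*) (\<lambda>y. B x y)) \<and>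
     (\<forall>y. Vector_Spaces.linear scale (*) (\<lambda>x. B x y)) \<and>
     (\<exists>x y. B x y \<noteq> 0) \<and>
     (\<forall>x y z. B x (y \<star> z) = B (x \<star> y) z)"

end

definition form_radical :: "('a \<Rightarrow> 'a \<Rightarrow> 'f::zero) \<Rightarrow> 'a set" where
  "form_radical B = {u. \<forall>v. B u v = 0}"

text \<open>A generating set of primitive axes, normalised by a Frobenius form.\<close>

definition (in nonassoc_algebra) normalised_axes :: "'a set \<Rightarrow> ('a \<Rightarrow> 'a \<Rightarrow> 'f) \<Rightarrow> bool" where
  "normalised_axes X B \<longleftrightarrow>
     X \<subseteq> primitive_axes \<and> generates X \<and> frobenius_form B \<and> (\<forall>x\<in>X. B x x = 1)"

end

(* For a primitive axis a write u = phi a u a + null_proj a u + odd_proj a u.  Axes x, y multiply into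
   the span of x, y and the image of y under the Miyamoto involution of x, so a generating set of
   axes closed under these involutions spans A.  If moreover phi x y = phi y x for all its members,
   the functionals phi x glue to a symmetric bilinear form, which is associative because the Peirce
   components of an axis are orthogonal.

   For a noncommutative axis the symmetry always holds, and its odd part lies in the radical.  For
   commutative types l and m it holds unless l + m = 1, l \<noteq> m and xy \<noteq> 0; then 2 phi x y = 1 + m and
   2 phi y x = 1 + l.  In that exceptional case y is a combination of axes of type l, provided
   l \<noteq> -1, so from each pair {l, 1 - l} one type can be preferred (2 rather than -1) and the
   offending axes of the other type discarded.  An axis a of type -1 that has to be discarded because
   of b of type 2 satisfies phi a b = 3/2 and phi b a = 0, which puts it into the radical of every
   Frobenius form. *)

theory Submission
  imports Defs
begin

locale nonassoc_algebra_char_not_2 = nonassoc_algebra scale mult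
  for scale :: "'f::field \<Rightarrow> 'a::ab_group_add \<Rightarrow> 'a" (infixr \<open>*s\<close> 75)
    and mult :: "'a \<Rightarrow> 'a \<Rightarrow> 'a" (infixl \<open>\<star>\<close> 70) +
  assumes two_neq_0: "(2::'f) \<noteq> 0"
begin

section \<open>Bilinearity of the product\<close>

lemma star_add_right: "x \<star> (y + z) = x \<star> y + x \<star> z"
  using linear_mult_right[of x] by (simp add: Vector_Spaces.linear_iff)

lemma star_add_left: "(x + y) \<star> z = x \<star> z + y \<star> z"
  using linear_mult_left[of z] by (simp add: Vector_Spaces.linear_iff)

lemma star_scale_right: "x \<star> (r *s y) = r *s (x \<star> y)"
  using linear_mult_right[of x] by (simp add: Vector_Spaces.linear_iff)

lemma star_scale_left: "(r *s x) \<star> y = r *s (x \<star> y)"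
  using linear_mult_left[of y] by (simp add: Vector_Spaces.linear_iff)

lemma star_zero_right: "x \<star> 0 = 0"
  using star_scale_right[of x 0 0] by simp

lemma star_zero_left: "0 \<star> x = 0"
  using star_scale_left[of 0 0 x] by simp

lemma star_minus_right: "x \<star> (- y) = - (x \<star> y)"
  using star_scale_right[of x "-1" y] by simp

lemma star_minus_left: "(- x) \<star> y = - (x \<star> y)"
  using star_scale_left[of "-1" x y] by simp

lemma star_diff_right: "x \<star> (y - z) = x \<star> y - x \<star> z"
  using star_add_right[of x y "- z"] by (simp add: star_minus_right)

lemma star_diff_left: "(x - y) \<star> z = x \<star> z - y \<star> z"
  using star_add_left[of x "- y" z] by (simp add: star_minus_left)

lemmas star_simps = star_add_right star_add_left star_scale_right star_scale_left
  star_zero_right star_zero_left star_minus_right star_minus_left star_diff_right star_diff_left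

section \<open>Uniqueness and existence of the Peirce decomposition at an axis\<close>

definition even_part :: "'a \<Rightarrow> 'a set" where
  "even_part a = {u + y | u y. u \<in> span {a} \<and> y \<in> null_part a}"

lemma even_part_iff: "v \<in> even_part a \<longleftrightarrow> (\<exists>p y. y \<in> null_part a \<and> v = p *s a + y)"
  unfolding even_part_def span_singleton by auto

lemma null_partD: "y \<in> null_part a \<Longrightarrow> a \<star> y = 0" "y \<in> null_part a \<Longrightarrow> y \<star> a = 0"
  by (auto simp: null_part_def)

lemma eigen_partD: "z \<in> eigen_part l d a \<Longrightarrow> a \<star> z = l *s z"
  "z \<in> eigen_part l d a \<Longrightarrow> z \<star> a = d *s z"
  by (auto simp: eigen_part_def)

lemma subspace_null_part: "subspace (null_part a)"
  by (auto simp: subspace_def null_part_def star_simps)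

lemma subspace_eigen_part: "subspace (eigen_part l d a)"
  by (auto simp: subspace_def eigen_part_def star_simps algebra_simps)

lemma subspace_even_part: "subspace (even_part a)"
  unfolding even_part_def using subspace_sums[OF subspace_span subspace_null_part] by simp

text \<open>The two odd components may belong to different types: the decomposition with respect to
  a primitive axis does not depend on the type.\<close>

lemma peirce_unique:
  assumes "a \<noteq> 0" "a \<star> a = a" "l \<notin> {0, 1}" "l' \<notin> {0, 1}"
    and "y \<in> null_part a" "y' \<in> null_part a" "z \<in> eigen_part l d a" "z' \<in> eigen_part l' d' a"
    and eq: "p *s a + y + z = p' *s a + y' + z'"
  shows "p = p' \<and> y = y' \<and> z = z'"
proof -
  note D = null_partD(1)[OF assms(5)] null_partD(1)[OF assms(6)]
    eigen_partD(1)[OF assms(7)] eigen_partD(1)[OF assms(8)]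
  have 1: "p *s a + l *s z = p' *s a + l' *s z'"
    using arg_cong[OF eq, of "\<lambda>u. a \<star> u"] by (simp add: star_simps D assms(2))
  have 2: "p *s a + (l * l) *s z = p' *s a + (l' * l') *s z'"
    using arg_cong[OF 1, of "\<lambda>u. a \<star> u"] by (simp add: star_simps D assms(2))
  \<comment> \<open>Multiplication by \<open>a\<close> kills the null parts and fixes
    \<open>a\<close>, so the difference of the two previous equations involves odd parts only. One
    further multiplication then separates \<open>l\<close> from \<open>l'\<close>.\<close>
  have 3: "(l * l - l) *s z = (l' * l' - l') *s z'"
    using arg_cong2[OF 2 1, of "(-)"] by (simp add: algebra_simps)
  have nz: "l * l - l \<noteq> 0" "l' * l' - l' \<noteq> 0"
    using assms(3,4) by auto
  have 4: "l *s ((l * l - l) *s z) = l' *s ((l' * l' - l') *s z')"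
    using arg_cong[OF 3, of "\<lambda>u. a \<star> u"] by (simp add: star_simps D mult.commute)
  have "(l - l') *s ((l * l - l) *s z) = 0"
    using 4 unfolding 3[symmetric] by (simp only: scale_left_diff_distrib) simp
  hence "l = l' \<or> z = 0" using nz by auto
  hence z: "z = z'"
  proof
    assume "l = l'"
    thus ?thesis using 3 nz by simp
  next
    assume "z = 0"
    thus ?thesis using 3 nz by simp
  qed
  have "(l - l') *s z = 0" using 4 unfolding 3[symmetric] using nz z
    by (metis \<open>l = l' \<or> z = 0\<close> diff_self scale_eq_0_iff)
  hence "l *s z = l' *s z'" using z by (simp add: scale_left_diff_distrib)
  hence "p = p'" using 1 assms(1) by simp
  thus ?thesis using eq z by simp
qed

lemma primitive_axis_parts:
  assumes "primitive_axis l d a"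
  shows "l \<noteq> 0" "l \<noteq> 1" "d \<noteq> 0" "d \<noteq> 1" "l \<noteq> d \<longrightarrow> l + d = 1" "a \<noteq> 0" "a \<star> a = a"
    "Z2_grading (even_part a) (eigen_part l d a)"
    "\<exists>p y z. y \<in> null_part a \<and> z \<in> eigen_part l d a \<and> u = p *s a + y + z"
proof -
  show "l \<noteq> 0" "l \<noteq> 1" "d \<noteq> 0" "d \<noteq> 1" "l \<noteq> d \<longrightarrow> l + d = 1" "a \<noteq> 0" "a \<star> a = a"
    "Z2_grading (even_part a) (eigen_part l d a)"
    using assms by (auto simp: primitive_axis_def even_part_def)
  have "u \<in> (\<lambda>(u, y, z). u + y + z) ` (span {a} \<times> null_part a \<times> eigen_part l d a)"
    using assms unfolding primitive_axis_def bij_betw_def by simp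
  thus "\<exists>p y z. y \<in> null_part a \<and> z \<in> eigen_part l d a \<and> u = p *s a + y + z"
    unfolding span_singleton by auto
qed

text \<open>Uniqueness of the decomposition yields the injectivity of the direct sum maps and, since
  \<open>l\<close> and \<open>d\<close> differ from 1, both conditions on fixed vectors. Hence only
  the existence of decompositions and the fusion rules must be transported to a conjugate
  axis.\<close>

lemma primitive_axisI:
  assumes l: "l \<notin> {0, 1}" and d: "d \<notin> {0, 1}" and ld: "l \<noteq> d \<longrightarrow> l + d = 1"
    and a: "a \<noteq> 0" "a \<star> a = a"
    and dec: "\<And>u. \<exists>p y z. y \<in> null_part a \<and> z \<in> eigen_part l d a \<and> u = p *s a + y + z"
    and gr: "\<And>x y. x \<in> even_part a \<Longrightarrow> y \<in> even_part a \<Longrightarrow> x \<star> y \<in> even_part a"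
      "\<And>x y. x \<in> even_part a \<Longrightarrow> y \<in> eigen_part l d a \<Longrightarrow> x \<star> y \<in> eigen_part l d a"
      "\<And>x y. x \<in> eigen_part l d a \<Longrightarrow> y \<in> even_part a \<Longrightarrow> x \<star> y \<in> eigen_part l d a"
      "\<And>x y. x \<in> eigen_part l d a \<Longrightarrow> y \<in> eigen_part l d a \<Longrightarrow> x \<star> y \<in> even_part a"
  shows "primitive_axis l d a"
proof -
  have U: "p = p' \<and> y = y' \<and> z = z'"
    if "y \<in> null_part a" "y' \<in> null_part a" "z \<in> eigen_part l d a" "z' \<in> eigen_part l d a"
      "p *s a + y + z = p' *s a + y' + z'" for p p' y y' z z'
    using peirce_unique[OF a l l that] .
  have fix_left: "{y. a \<star> y = y} = span {a}"
  proof (intro equalityI subsetI; clarsimp simp: span_singleton star_simps a)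
    fix u assume *: "a \<star> u = u"
    obtain p y z where u: "y \<in> null_part a" "z \<in> eigen_part l d a" "u = p *s a + y + z"
      using dec by blast
    have "p *s a + 0 + l *s z = p *s a + y + z"
      using * u by (simp add: star_simps a null_partD eigen_partD)
    from U[OF _ _ _ _ this] u have "y = 0" "l *s z = z"
      using subspace_0[OF subspace_null_part] subspace_scale[OF subspace_eigen_part] by auto
    hence "y = 0" "z = 0" using l
      by (auto simp: scale_eq_0_iff dest: arg_cong[of _ _ "\<lambda>x. x - z"] simp flip: scale_left_diff_distrib)
        (metis diff_self eq_iff_diff_eq_0 scale_cancel_right scale_one)
    thus "u \<in> range (\<lambda>k. k *s a)" using u by auto
  qed
  have fix_right: "{y. y \<star> a = y} = span {a}"
  proof (intro equalityI subsetI; clarsimp simp: span_singleton star_simps a)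
    fix u assume *: "u \<star> a = u"
    obtain p y z where u: "y \<in> null_part a" "z \<in> eigen_part l d a" "u = p *s a + y + z"
      using dec by blast
    have "p *s a + 0 + d *s z = p *s a + y + z"
      using * u by (simp add: star_simps a null_partD eigen_partD)
    from U[OF _ _ _ _ this] u have "y = 0" "d *s z = z"
      using subspace_0[OF subspace_null_part] subspace_scale[OF subspace_eigen_part] by auto
    hence "y = 0" "z = 0" using d
      by (auto) (metis scale_cancel_right scale_one)
    thus "u \<in> range (\<lambda>k. k *s a)" using u by auto
  qed
  have bij3: "bij_betw (\<lambda>(u, y, z). u + y + z) (span {a} \<times> null_part a \<times> eigen_part l d a) UNIV"
  proof (rule bij_betw_imageI)
    show "inj_on (\<lambda>(u, y, z). u + y + z) (span {a} \<times> null_part a \<times> eigen_part l d a)"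
      by (rule inj_onI) (use U in \<open>auto simp: span_singleton\<close>)
    show "(\<lambda>(u, y, z). u + y + z) ` (span {a} \<times> null_part a \<times> eigen_part l d a) = UNIV"
    proof (intro equalityI subsetI; clarsimp)
      fix u
      obtain p y z where u: "y \<in> null_part a" "z \<in> eigen_part l d a" "u = p *s a + y + z"
        using dec by blast
      thus "u \<in> (\<lambda>(u, y, z). u + y + z) ` (span {a} \<times> null_part a \<times> eigen_part l d a)"
        by (intro image_eqI[of _ _ "(p *s a, y, z)"]) (auto simp: span_singleton)
    qed
  qed
  have bij2: "bij_betw (\<lambda>(x, y). x + y) (even_part a \<times> eigen_part l d a) UNIV"
  proof (rule bij_betw_imageI)
    show "inj_on (\<lambda>(x, y). x + y) (even_part a \<times> eigen_part l d a)"
      by (rule inj_onI) (use U in \<open>fastforce simp: even_part_iff\<close>)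
    show "(\<lambda>(x, y). x + y) ` (even_part a \<times> eigen_part l d a) = UNIV"
    proof (intro equalityI subsetI; clarsimp)
      fix u
      obtain p y z where u: "y \<in> null_part a" "z \<in> eigen_part l d a" "u = p *s a + y + z"
        using dec by blast
      thus "u \<in> (\<lambda>(x, y). x + y) ` (even_part a \<times> eigen_part l d a)"
        by (intro image_eqI[of _ _ "(p *s a + y, z)"]) (auto simp: even_part_iff)
    qed
  qed
  show ?thesis
    unfolding primitive_axis_def Z2_grading_def even_part_def[symmetric]
    using l d ld a fix_left fix_right bij3 bij2 subspace_even_part subspace_eigen_part gr
    by simp
qed

section \<open>The Peirce coefficient and the projections\<close>

text \<open>Binding the type inside the description makes the coefficient a function of
  \<open>a\<close> and \<open>u\<close> alone; \<open>peirce_unique\<close> permits this because it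
  compares decompositions of different types.\<close>

definition phi :: "'a \<Rightarrow> 'a \<Rightarrow> 'f" where
  "phi a u = (THE p. \<exists>l d y z. primitive_axis l d a \<and> y \<in> null_part a \<and> z \<in> eigen_part l d a \<and>
     u = p *s a + y + z)"

definition odd_proj :: "'a \<Rightarrow> 'a \<Rightarrow> 'a" where
  "odd_proj a u = (THE z. \<exists>l d p y. primitive_axis l d a \<and> y \<in> null_part a \<and> z \<in> eigen_part l d a \<and>
     u = p *s a + y + z)"

definition null_proj :: "'a \<Rightarrow> 'a \<Rightarrow> 'a" where
  "null_proj a u = u - phi a u *s a - odd_proj a u"

lemma peirce_eqI:
  assumes "primitive_axis l d a" "y \<in> null_part a" "z \<in> eigen_part l d a" "u = p *s a + y + z"
  shows "phi a u = p" "odd_proj a u = z" "null_proj a u = y"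
proof -
  note a = primitive_axis_parts[OF assms(1)]
  have U: "p = p' \<and> y = y' \<and> z = z'"
    if "primitive_axis l' d' a" "y' \<in> null_part a" "z' \<in> eigen_part l' d' a"
      "u = p' *s a + y' + z'" for l' d' p' y' z'
    using a(1,2) primitive_axis_parts[OF that(1)]
    by (intro peirce_unique[OF a(6,7) _ _ assms(2) that(2) assms(3) that(3)])
      (simp_all add: that(4)[symmetric] assms(4)[symmetric])
  show 1: "phi a u = p"
    unfolding phi_def by (rule the_equality) (use assms U in blast)+
  show 2: "odd_proj a u = z"
    unfolding odd_proj_def by (rule the_equality) (use assms U in blast)+
  show "null_proj a u = y"
    unfolding null_proj_def 1 2 by (simp add: assms(4))
qed

lemma peirce_parts:
  assumes "primitive_axis l d a"
  shows "null_proj a u \<in> null_part a" "odd_proj a u \<in> eigen_part l d a"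
    "u = phi a u *s a + null_proj a u + odd_proj a u"
proof -
  obtain p y z where "y \<in> null_part a" "z \<in> eigen_part l d a" "u = p *s a + y + z"
    using primitive_axis_parts(9)[OF assms] by blast
  with peirce_eqI[OF assms this]
  show "null_proj a u \<in> null_part a" "odd_proj a u \<in> eigen_part l d a"
    "u = phi a u *s a + null_proj a u + odd_proj a u" by simp_all
qed

lemma peirce_add:
  assumes "a \<in> primitive_axes"
  shows "phi a (u + v) = phi a u + phi a v" "odd_proj a (u + v) = odd_proj a u + odd_proj a v"
    "null_proj a (u + v) = null_proj a u + null_proj a v"
proof -
  obtain l d where a: "primitive_axis l d a" using assms by (auto simp: primitive_axes_def)
  have *: "u + v = (phi a u + phi a v) *s a + (null_proj a u + null_proj a v) + (odd_proj a u + odd_proj a v)"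
    using arg_cong2[OF peirce_parts(3)[OF a, of u] peirce_parts(3)[OF a, of v], of "(+)"]
    by (simp only: scale_left_distrib ac_simps)
  show "phi a (u + v) = phi a u + phi a v" "odd_proj a (u + v) = odd_proj a u + odd_proj a v"
    "null_proj a (u + v) = null_proj a u + null_proj a v"
    using peirce_eqI[OF a _ _ *] peirce_parts[OF a]
      subspace_add[OF subspace_null_part] subspace_add[OF subspace_eigen_part] by auto
qed

lemma peirce_scale:
  assumes "a \<in> primitive_axes"
  shows "phi a (r *s u) = r * phi a u" "odd_proj a (r *s u) = r *s odd_proj a u"
    "null_proj a (r *s u) = r *s null_proj a u"
proof -
  obtain l d where a: "primitive_axis l d a" using assms by (auto simp: primitive_axes_def)
  have *: "r *s u = (r * phi a u) *s a + r *s null_proj a u + r *s odd_proj a u"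
    by (subst peirce_parts(3)[OF a, of u]) (simp add: scale_right_distrib)
  show "phi a (r *s u) = r * phi a u" "odd_proj a (r *s u) = r *s odd_proj a u"
    "null_proj a (r *s u) = r *s null_proj a u"
    using peirce_eqI[OF a _ _ *] peirce_parts[OF a]
      subspace_scale[OF subspace_null_part] subspace_scale[OF subspace_eigen_part] by auto
qed

lemma peirce_minus:
  assumes "a \<in> primitive_axes"
  shows "phi a (- u) = - phi a u" "odd_proj a (- u) = - odd_proj a u"
  using peirce_scale[OF assms, of "-1" u] by simp_all

lemma peirce_diff:
  assumes "a \<in> primitive_axes"
  shows "phi a (u - v) = phi a u - phi a v" "odd_proj a (u - v) = odd_proj a u - odd_proj a v"
  using peirce_add[OF assms, of u "- v"] by (simp_all add: peirce_minus[OF assms])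

lemma peirce_zero:
  assumes "a \<in> primitive_axes"
  shows "phi a 0 = 0" "odd_proj a 0 = 0"
  using peirce_scale[OF assms, of 0 0] by simp_all

lemma primitive_axesI: "primitive_axis l d a \<Longrightarrow> a \<in> primitive_axes"
  by (auto simp: primitive_axes_def)

lemma peirce_self:
  assumes "a \<in> primitive_axes"
  shows "phi a a = 1" "odd_proj a a = 0"
proof -
  obtain l d where a: "primitive_axis l d a" using assms by (auto simp: primitive_axes_def)
  show "phi a a = 1" "odd_proj a a = 0"
    using peirce_eqI[OF a subspace_0[OF subspace_null_part] subspace_0[OF subspace_eigen_part],
        of a 1] by simp_all
qed

lemma peirce_null:
  assumes "a \<in> primitive_axes" "y \<in> null_part a"
  shows "phi a y = 0" "odd_proj a y = 0"
proof -
  obtain l d where a: "primitive_axis l d a" using assms by (auto simp: primitive_axes_def)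
  show "phi a y = 0" "odd_proj a y = 0"
    using peirce_eqI[OF a assms(2) subspace_0[OF subspace_eigen_part], of y 0] by simp_all
qed

lemma peirce_eigen:
  assumes "primitive_axis l d a" "z \<in> eigen_part l d a"
  shows "phi a z = 0" "odd_proj a z = z"
  using peirce_eqI[OF assms(1) subspace_0[OF subspace_null_part] assms(2), of z 0] by simp_all

lemma peirce_odd_proj:
  assumes "a \<in> primitive_axes"
  shows "phi a (odd_proj a u) = 0" "odd_proj a (odd_proj a u) = odd_proj a u"
proof -
  obtain l d where a: "primitive_axis l d a" using assms by (auto simp: primitive_axes_def)
  show "phi a (odd_proj a u) = 0" "odd_proj a (odd_proj a u) = odd_proj a u"
    using peirce_eigen[OF a peirce_parts(2)[OF a]] by simp_all
qed

lemmas peirce_simps = peirce_add peirce_scale peirce_minus peirce_diff peirce_zero peirce_self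
  peirce_odd_proj

lemma axis_mult:
  assumes "primitive_axis l d a"
  shows "a \<star> u = phi a u *s a + l *s odd_proj a u" "u \<star> a = phi a u *s a + d *s odd_proj a u"
proof -
  note p = peirce_parts[OF assms, of u] and a = primitive_axis_parts[OF assms]
  show "a \<star> u = phi a u *s a + l *s odd_proj a u"
    by (subst p(3)) (simp add: star_simps a(7) null_partD(1)[OF p(1)] eigen_partD(1)[OF p(2)])
  show "u \<star> a = phi a u *s a + d *s odd_proj a u"
    by (subst p(3)) (simp add: star_simps a(7) null_partD(2)[OF p(1)] eigen_partD(2)[OF p(2)])
qed

lemma odd_proj_eq_0:
  assumes "a \<in> primitive_axes" "u \<in> even_part a"
  shows "odd_proj a u = 0"
  using assms by (auto simp: even_part_iff peirce_simps peirce_null)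

text \<open>By the grading, the odd component of a product comes from even times odd and odd times
  even; \<open>u - odd_proj a u\<close> is the even component of \<open>u\<close>.\<close>

lemma odd_proj_mult:
  assumes "a \<in> primitive_axes"
  shows "odd_proj a (u \<star> v) =
    (u - odd_proj a u) \<star> odd_proj a v + odd_proj a u \<star> (v - odd_proj a v)"
proof -
  obtain l d where a: "primitive_axis l d a" using assms by (auto simp: primitive_axes_def)
  have ev: "x - odd_proj a x \<in> even_part a" for x
    using peirce_parts(1)[OF a, of x] unfolding even_part_iff
    by (intro exI[of _ "phi a x"] exI[of _ "null_proj a x"]) (simp add: null_proj_def)
  note od = peirce_parts(2)[OF a]
  note gr = primitive_axis_parts(8)[OF a, unfolded Z2_grading_def]
  let ?e = "(u - odd_proj a u) \<star> (v - odd_proj a v) + odd_proj a u \<star> odd_proj a v"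
  let ?o = "(u - odd_proj a u) \<star> odd_proj a v + odd_proj a u \<star> (v - odd_proj a v)"
  have 1: "?e \<in> even_part a" using gr ev od by (intro subspace_add[OF subspace_even_part]) blast+
  have 2: "?o \<in> eigen_part l d a" using gr ev od by (intro subspace_add[OF subspace_eigen_part]) blast+
  have "u \<star> v = ?e + ?o" by (simp add: star_simps)
  hence "odd_proj a (u \<star> v) = odd_proj a ?e + odd_proj a ?o"
    by (simp only: peirce_add(2)[OF assms])
  thus ?thesis using odd_proj_eq_0[OF assms 1] peirce_eigen(2)[OF a 2] by simp
qed

subsection \<open>Miyamoto involutions\<close>

text \<open>Algebra automorphisms of order at most two; the identity is included because
  \<open>miy a\<close> is the identity when the odd part of \<open>a\<close> vanishes.\<close>

definition involution :: "('a \<Rightarrow> 'a) \<Rightarrow> bool" where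
  "involution g \<longleftrightarrow> (\<forall>x y. g (x + y) = g x + g y) \<and> (\<forall>r x. g (r *s x) = r *s g x) \<and>
     (\<forall>x y. g (x \<star> y) = g x \<star> g y) \<and> (\<forall>x. g (g x) = x)"

text \<open>Acts as 1 on the even part of \<open>a\<close> and as -1 on the odd part.\<close>

definition miy :: "'a \<Rightarrow> 'a \<Rightarrow> 'a" where
  "miy a u = u - (odd_proj a u + odd_proj a u)"

lemma involution_miy:
  assumes "a \<in> primitive_axes"
  shows "involution (miy a)"
  unfolding involution_def miy_def
  by (simp add: peirce_simps assms odd_proj_mult star_simps algebra_simps)

lemma involutionD:
  assumes "involution g"
  shows "g (x + y) = g x + g y" "g (r *s x) = r *s g x" "g (x \<star> y) = g x \<star> g y" "g (g x) = x"
    "g 0 = 0" "g (- x) = - g x" "g (x - y) = g x - g y"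
proof -
  show 1: "g (x + y) = g x + g y" "g (r *s x) = r *s g x" "g (x \<star> y) = g x \<star> g y" "g (g x) = x"
    for x y r using assms by (auto simp: involution_def)
  show "g 0 = 0" using 1(2)[of 0 0] by simp
  show 2: "g (- x) = - g x" for x using 1(2)[of "-1" x] by simp
  show "g (x - y) = g x - g y" using 1(1)[of x "- y"] 2[of y] by simp
qed

lemma involution_parts:
  assumes "involution g"
  shows "g u \<in> null_part (g a) \<longleftrightarrow> u \<in> null_part a"
    "g u \<in> eigen_part l d (g a) \<longleftrightarrow> u \<in> eigen_part l d a"
    "g u \<in> even_part (g a) \<longleftrightarrow> u \<in> even_part a"
proof -
  note g = involutionD[OF assms]
  have inj: "g x = g y \<longleftrightarrow> x = y" for x y using g(4) by metis
  show 1: "g u \<in> null_part (g a) \<longleftrightarrow> u \<in> null_part a" for u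
    using inj[of _ 0] by (simp add: null_part_def g(3)[symmetric] g(5))
  show "g u \<in> eigen_part l d (g a) \<longleftrightarrow> u \<in> eigen_part l d a"
    by (simp add: eigen_part_def g(2,3)[symmetric] inj)
  show "g u \<in> even_part (g a) \<longleftrightarrow> u \<in> even_part a"
  proof
    assume "g u \<in> even_part (g a)"
    then obtain p y where y: "y \<in> null_part (g a)" "g u = p *s g a + y"
      unfolding even_part_iff by blast
    have "g y \<in> null_part a" using 1[of "g y"] y by (simp add: g(4))
    moreover have "u = p *s a + g y" using arg_cong[OF y(2), of g] by (simp add: g(1,2,4))
    ultimately show "u \<in> even_part a" unfolding even_part_iff by blast
  next
    assume "u \<in> even_part a"
    thus "g u \<in> even_part (g a)" unfolding even_part_iff using 1 g(1,2) by metis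
  qed
qed

lemma primitive_axis_involution:
  assumes g: "involution g" and a: "primitive_axis l d a"
  shows "primitive_axis l d (g a)"
proof -
  note gs = involutionD[OF g] and ip = involution_parts[OF g]
  note p = primitive_axis_parts[OF a]
  note gr = p(8)[unfolded Z2_grading_def]
  show ?thesis
  proof (rule primitive_axisI)
    show "g a \<noteq> 0" using p(6) gs(4,5) by metis
    show "g a \<star> g a = g a" using p(7) by (simp add: gs(3)[symmetric])
    show "\<exists>p y z. y \<in> null_part (g a) \<and> z \<in> eigen_part l d (g a) \<and> u = p *s g a + y + z" for u
    proof -
      obtain p y z where y: "y \<in> null_part a" "z \<in> eigen_part l d a" "g u = p *s a + y + z"
        using p(9) by blast
      have "u = p *s g a + g y + g z" using arg_cong[OF y(3), of g] by (simp add: gs(1,2,4))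
      thus ?thesis using y ip(1,2) by blast
    qed
    fix x y
    have gg: "x = g (g x)" "y = g (g y)" by (simp_all add: gs(4))
    show "x \<star> y \<in> even_part (g a)" if "x \<in> even_part (g a)" "y \<in> even_part (g a)"
      using that gr ip by (subst gg(1), subst gg(2)) (metis gs(3,4))
    show "x \<star> y \<in> eigen_part l d (g a)" if "x \<in> even_part (g a)" "y \<in> eigen_part l d (g a)"
      using that gr ip by (subst gg(1), subst gg(2)) (metis gs(3,4))
    show "x \<star> y \<in> eigen_part l d (g a)" if "x \<in> eigen_part l d (g a)" "y \<in> even_part (g a)"
      using that gr ip by (subst gg(1), subst gg(2)) (metis gs(3,4))
    show "x \<star> y \<in> even_part (g a)" if "x \<in> eigen_part l d (g a)" "y \<in> eigen_part l d (g a)"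
      using that gr ip by (subst gg(1), subst gg(2)) (metis gs(3,4))
  qed (use p in auto)
qed

lemma primitive_axes_involution:
  "involution g \<Longrightarrow> a \<in> primitive_axes \<Longrightarrow> g a \<in> primitive_axes"
  using primitive_axis_involution by (fastforce simp: primitive_axes_def)

lemma peirce_involution:
  assumes g: "involution g" and a: "a \<in> primitive_axes"
  shows "phi (g a) (g u) = phi a u" "odd_proj (g a) (g u) = g (odd_proj a u)"
proof -
  obtain l d where ld: "primitive_axis l d a" using a by (auto simp: primitive_axes_def)
  note gs = involutionD[OF g] and ip = involution_parts[OF g] and p = peirce_parts[OF ld, of u]
  have "g u = phi a u *s g a + g (null_proj a u) + g (odd_proj a u)"
    by (subst p(3)) (simp add: gs)
  from peirce_eqI[OF primitive_axis_involution[OF g ld] _ _ this] p ip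
  show "phi (g a) (g u) = phi a u" "odd_proj (g a) (g u) = g (odd_proj a u)" by auto
qed

lemma eq_scale_half:
  assumes "x + x = y"
  shows "x = (1 / 2) *s y"
proof -
  have "(1 / 2) *s (x + x) = (1 / 2 + 1 / 2) *s x"
    by (simp only: scale_left_distrib scale_right_distrib)
  also have "(1 / 2 + 1 / 2 :: 'f) = 1"
    using two_neq_0 by (simp flip: add_divide_distrib)
  finally show ?thesis using assms by simp
qed

text \<open>In characteristic not 2, \<open>odd_proj x y\<close> is half of
  \<open>y - miy x y\<close>, so products of members of \<open>G\<close> stay in the span;
  bilinearity does the rest.\<close>

lemma subalgebra_span_axes:
  assumes "G \<subseteq> primitive_axes" and "\<And>x y. x \<in> G \<Longrightarrow> y \<in> G \<Longrightarrow> miy x y \<in> G"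
  shows "subalgebra (span G)"
proof -
  have 1: "x \<star> y \<in> span G" if x: "x \<in> G" and y: "y \<in> G" for x y
  proof -
    obtain l d where ld: "primitive_axis l d x" using x assms(1) by (auto simp: primitive_axes_def)
    have "odd_proj x y + odd_proj x y = y - miy x y" by (simp add: miy_def)
    from eq_scale_half[OF this] have "odd_proj x y \<in> span G"
      using x y assms(2) by (metis span_base span_diff span_scale)
    thus ?thesis unfolding axis_mult(1)[OF ld]
      using x by (intro span_add span_scale) (auto intro: span_base)
  qed
  have 2: "x \<star> y \<in> span G" if x: "x \<in> G" and y: "y \<in> span G" for x y
    using y by (induction rule: span_induct_alt)
      (use 1 x in \<open>auto simp: star_simps span_zero intro: span_add span_scale\<close>)
  have "x \<star> y \<in> span G" if x: "x \<in> span G" and y: "y \<in> span G" for x y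
    using x by (induction rule: span_induct_alt)
      (use 2 y in \<open>auto simp: star_simps span_zero intro: span_add span_scale\<close>)
  thus ?thesis by (simp add: subalgebra_def)
qed

lemma primitive_axis_type_unique:
  assumes "primitive_axis l d a" "primitive_axis l' d' a" "odd_proj a u \<noteq> 0"
  shows "l = l'" "d = d'"
proof -
  have "l *s odd_proj a u = l' *s odd_proj a u" "d *s odd_proj a u = d' *s odd_proj a u"
    using eigen_partD[OF peirce_parts(2)[OF assms(1)], of u]
      eigen_partD[OF peirce_parts(2)[OF assms(2)], of u] by metis+
  thus "l = l'" "d = d'" using assms(3) by auto
qed

subsection \<open>Pairs of axes\<close>

text \<open>Here \<open>a \<star> b\<close> is a multiple of \<open>a\<close>. Expanding the same
  product at \<open>b\<close> and applying \<open>phi b\<close> and \<open>odd_proj b\<close> leaves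
  three cases, the last of which is contradictory.\<close>

lemma odd_proj_zero_cases:
  assumes a: "primitive_axis l d a" and b: "primitive_axis m n b" and z: "odd_proj a b = 0"
  shows "a = b \<or> (phi a b = 0 \<and> phi b a = 0 \<and> odd_proj b a = 0)"
proof -
  have A: "a \<in> primitive_axes" "b \<in> primitive_axes" using a b by (auto intro: primitive_axesI)
  note pa = primitive_axis_parts[OF a] and pb = primitive_axis_parts[OF b]
  let ?r = "phi a b" and ?s = "phi b a" and ?w = "odd_proj b a"
  have 1: "?r *s a = ?s *s b + n *s ?w"
    using axis_mult(1)[OF a, of b] axis_mult(2)[OF b, of a] z by simp
  have 2: "?r * ?s = ?s" using arg_cong[OF 1, of "phi b"] by (simp add: peirce_simps A)
  have 3: "?r *s ?w = n *s ?w" using arg_cong[OF 1, of "odd_proj b"] by (simp add: peirce_simps A)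
  consider "?r = 0" | "?w = 0" "?r \<noteq> 0" | "?r = n" "?w \<noteq> 0" "?r \<noteq> 0" using 3 by auto
  thus ?thesis
  proof cases
    case 1
    thus ?thesis using 2 3 pb(3) by auto
  next
    case c: 2
    hence e: "?r *s a = ?s *s b" using 1 by simp
    have "?s \<noteq> 0" using e c(2) pa(6) by auto
    hence "?r = 1" using 2 by simp
    hence e: "a = ?s *s b" using e by simp
    have "a \<star> a = (?s * ?s) *s b" by (subst (1 2) e) (simp add: star_simps pb(7))
    hence "(?s * ?s) *s b = ?s *s b" using e pa(7) by metis
    hence "?s = 1" using \<open>?s \<noteq> 0\<close> pb(6) by simp
    thus ?thesis using e by simp
  next
    case c: 3
    have "?s = 0" using 2 c(1) pb(4) by simp
    hence e: "a = ?w" using 1 c by simp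
    \<comment> \<open>Now \<open>a\<close> is odd with respect to \<open>b\<close>, but its square
      \<open>a \<star> a = a\<close> is even, which forces \<open>a = 0\<close>.\<close>
    have "odd_proj b (a \<star> a) = 0" by (subst odd_proj_mult[OF A(2)]) (simp add: e[symmetric] star_simps)
    thus ?thesis using e pa(6,7) by simp
  qed
qed

lemma odd_proj_zero_sym:
  assumes "primitive_axis l d a" "primitive_axis m n b"
  shows "odd_proj a b = 0 \<longleftrightarrow> odd_proj b a = 0"
  using odd_proj_zero_cases[OF assms] odd_proj_zero_cases[OF assms(2,1)] by metis

text \<open>Expand \<open>a \<star> b\<close> and \<open>b \<star> a\<close> at both axes.
  Subtracting the results cancels the \<open>phi\<close> terms and makes the two odd components
  proportional, so both are killed by \<open>phi a\<close> and \<open>phi b\<close>. With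
  \<open>r = phi a b\<close> and \<open>s = phi b a\<close> this leaves \<open>r = s * r\<close> and
  \<open>r * s = s\<close>.\<close>

lemma noncommutative_phi:
  assumes a: "primitive_axis l d a" and b: "primitive_axis m n b" and ld: "l \<noteq> d"
  shows "phi a b = phi b a" "phi a b \<in> {0, 1}"
    "(l - d) *s odd_proj a b = (n - m) *s odd_proj b a"
proof -
  have A: "a \<in> primitive_axes" "b \<in> primitive_axes" using a b by (auto intro: primitive_axesI)
  note E1 = trans[OF axis_mult(1)[OF a, of b, symmetric] axis_mult(2)[OF b]]
    and E2 = trans[OF axis_mult(2)[OF a, of b, symmetric] axis_mult(1)[OF b]]
  show c: "(l - d) *s odd_proj a b = (n - m) *s odd_proj b a"
    using arg_cong2[OF E1 E2, of "(-)"] by (simp add: algebra_simps)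
  have "phi a b = phi b a \<and> phi a b \<in> {0, 1}"
  proof (cases "odd_proj a b = 0")
    case True
    thus ?thesis using odd_proj_zero_cases[OF a b True] peirce_self A by auto
  next
    case False
    hence "n \<noteq> m" using c ld by auto
    have "phi a (odd_proj b a) = 0"
      using arg_cong[OF c, of "phi a"] \<open>n \<noteq> m\<close> by (simp add: peirce_simps A)
    hence 1: "phi a b = phi b a * phi a b"
      using arg_cong[OF E1, of "phi a"] by (simp add: peirce_simps A)
    have "phi b (odd_proj a b) = 0"
      using arg_cong[OF c, of "phi b"] ld by (simp add: peirce_simps A)
    hence 2: "phi a b * phi b a = phi b a"
      using arg_cong[OF E1, of "phi b"] by (simp add: peirce_simps A)
    show ?thesis using 1 2 by (auto simp: mult.commute)
  qed
  thus "phi a b = phi b a" "phi a b \<in> {0, 1}" by auto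
qed

text \<open>The axes \<open>a\<close> and \<open>a \<plusminus> 2 w\<close> with \<open>w\<close> the \<open>b\<close>-odd part of \<open>a\<close> are conjugate, and each of
  them has \<open>phi c\<close> value 0 or 1; this forces \<open>phi c w = 0\<close> in characteristic not 2.\<close>

lemma noncommutative_odd_radical_axis:
  assumes a: "primitive_axis l d a" and ld: "l \<noteq> d" and b: "b \<in> primitive_axes"
    and c: "c \<in> primitive_axes"
  shows "phi c (odd_proj a b) = 0"
proof (cases "odd_proj a b = 0")
  case True
  thus ?thesis using c by (simp add: peirce_simps)
next
  case False
  obtain m n where mn: "primitive_axis m n b" using b by (auto simp: primitive_axes_def)
  obtain m' n' where mn': "primitive_axis m' n' c" using c by (auto simp: primitive_axes_def)
  have A: "a \<in> primitive_axes" using a by (rule primitive_axesI)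
  let ?w = "odd_proj b a"
  note e = noncommutative_phi(3)[OF a mn ld]
  have "n \<noteq> m" using e ld False by auto
  \<comment> \<open>Since \<open>?w\<close> is proportional to \<open>odd_proj a b\<close>, it is
    odd for \<open>a\<close> as well; \<open>miy a\<close> therefore negates it and turns
    \<open>a - 2 w\<close> into \<open>a + 2 w\<close>.\<close>
  have "(n - m) *s odd_proj a ?w = odd_proj a ((l - d) *s odd_proj a b)"
    unfolding e by (simp only: peirce_scale(2)[OF A])
  also have "\<dots> = (n - m) *s ?w"
    by (simp only: peirce_scale(2)[OF A] peirce_odd_proj(2)[OF A]) (rule e)
  finally have ow: "odd_proj a ?w = ?w" using \<open>n \<noteq> m\<close> by simp
  have 01: "phi c (g a) \<in> {0, 1}" if "involution g" for g
    using noncommutative_phi[OF primitive_axis_involution[OF that a] mn' ld] by simp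
  have p1: "phi c a \<in> {0, 1}"
    using noncommutative_phi[OF a mn' ld] by simp
  have ib: "involution (miy b)" and ia: "involution (miy a)"
    using involution_miy A b by auto
  have p2: "phi c (a - (?w + ?w)) \<in> {0, 1}" using 01[OF ib] by (simp add: miy_def)
  have "miy a (miy b a) = a + (?w + ?w)"
    by (simp add: miy_def peirce_simps A ow)
  hence p3: "phi c (a + (?w + ?w)) \<in> {0, 1}"
    using noncommutative_phi[OF primitive_axis_involution[OF ia primitive_axis_involution[OF ib a]] mn' ld]
    by simp
  have "2 * phi c ?w = 0"
  proof -
    have "phi c a - 2 * phi c ?w \<in> {0, 1}" "phi c a + 2 * phi c ?w \<in> {0, 1}"
      using p2 p3 by (simp_all add: peirce_simps c)
    moreover have "(2::'f) \<noteq> 1" by (metis add_cancel_right_right one_add_one zero_neq_one)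
    \<comment> \<open>Applied with \<open>s = 2 * phi c ?w\<close>: three terms of an arithmetic
      progression lie in {0, 1} only if it is constant, as 2 is neither 0 nor 1.\<close>
    hence "s = 0" if "t \<in> {0, 1}" "t - s \<in> {0, 1}" "t + s \<in> {0, 1}" for s t :: 'f
      using that two_neq_0 by (auto simp: diff_eq_eq eq_neg_iff_add_eq_0)
    ultimately show ?thesis using p1 by blast
  qed
  hence "phi c ?w = 0" using two_neq_0 by simp
  hence "phi c ((l - d) *s odd_proj a b) = 0"
    unfolding e by (simp add: peirce_scale(1)[OF c])
  thus ?thesis using ld by (simp add: peirce_scale(1)[OF c])
qed

section \<open>Two commutative axes\<close>

lemma commutative_axis_commutes: "primitive_axis l l a \<Longrightarrow> a \<star> u = u \<star> a"
  by (simp add: axis_mult)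

lemma two_scale: "2 *s x = x + x"
  by (metis one_add_one scale_left_distrib scale_one)

text \<open>The last two relations are the odd and even components, at \<open>a\<close>, of
  \<open>b \<star> b = b\<close>. The first two are the odd and even components of the eigenvector
  equation for \<open>odd_proj b a\<close>, rewritten in terms of
  \<open>b \<star> a\<close>.\<close>

lemma commutative_pair_relations:
  assumes a: "primitive_axis l l a" and b: "primitive_axis m m b" and nz: "odd_proj a b \<noteq> 0"
  defines "\<alpha> \<equiv> phi a b" and "\<beta> \<equiv> phi b a" and "y \<equiv> null_proj a b" and "z \<equiv> odd_proj a b"
  shows "2 * l * \<alpha> + l - 2 * m * l = 2 * \<beta> * (1 - m)"
    "l *s (z \<star> z) = (\<beta> * (1 - m) * \<alpha> - \<alpha> * \<alpha> + m * \<alpha>) *s a + (\<beta> * (1 - m)) *s y"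
    "2 *s (y \<star> z) = (1 - 2 * \<alpha> * l) *s z"
    "(\<alpha> * \<alpha>) *s a + y \<star> y + z \<star> z = \<alpha> *s a + y"
proof -
  have A: "a \<in> primitive_axes" using a by (rule primitive_axesI)
  note pa = primitive_axis_parts[OF a] and pb = primitive_axis_parts[OF b]
  have y: "y \<in> null_part a" and z: "z \<in> eigen_part l l a" and bd: "b = \<alpha> *s a + y + z"
    using peirce_parts[OF a, of b] by (simp_all add: assms)
  note yz = null_partD[OF y] eigen_partD[OF z]
  have oz: "odd_proj a z = z" "odd_proj a b = z" "odd_proj a a = 0" "odd_proj a y = 0" "phi a z = 0"
    using A y by (simp_all add: z_def peirce_simps peirce_null)
  have ow: "odd_proj a (z \<star> z) = 0"
    by (simp add: odd_proj_mult[OF A] oz star_simps)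
  \<comment> \<open>The algebra need not be commutative, but the axis \<open>b\<close> commutes with
    everything, and the left factor is \<open>b - z\<close>.\<close>
  have comm: "(\<alpha> *s a + y) \<star> z = z \<star> (\<alpha> *s a + y)"
  proof -
    have "\<alpha> *s a + y = b - z" using bd by simp
    thus ?thesis using commutative_axis_commutes[OF b, of z] by (simp add: star_simps)
  qed
  have "z = odd_proj a (b \<star> b)" using pb(7) by (simp add: z_def)
  also have "\<dots> = (\<alpha> *s a + y) \<star> z + z \<star> (\<alpha> *s a + y)"
    using odd_proj_mult[OF A, of b b] bd oz(2) by (metis add_diff_cancel_right')
  finally have ez: "z = 2 *s ((\<alpha> *s a + y) \<star> z)" by (simp only: comm two_scale)
  show 3: "2 *s (y \<star> z) = (1 - 2 * \<alpha> * l) *s z"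
    using ez by (simp add: star_simps yz scale_right_distrib scale_left_diff_distrib algebra_simps)
  show 4: "(\<alpha> * \<alpha>) *s a + y \<star> y + z \<star> z = \<alpha> *s a + y"
  proof -
    have "(c + z) \<star> (c + z) = c \<star> c + z \<star> z + 2 *s (c \<star> z)" if "c \<star> z = z \<star> c" for c
      by (simp only: two_scale star_add_left star_add_right that ac_simps)
    from this[OF comm] have "b \<star> b = (\<alpha> *s a + y) \<star> (\<alpha> *s a + y) + z \<star> z + 2 *s ((\<alpha> *s a + y) \<star> z)"
      unfolding bd[symmetric] .
    hence "b = (\<alpha> *s a + y) \<star> (\<alpha> *s a + y) + z \<star> z + z" using ez pb(7) by simp
    hence "(\<alpha> *s a + y) \<star> (\<alpha> *s a + y) + z \<star> z = \<alpha> *s a + y" using bd by simp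
    thus ?thesis by (simp add: star_simps yz pa(7))
  qed
  have ba: "b \<star> a = \<alpha> *s a + l *s z"
    using axis_mult[OF a, of b] by (simp add: assms)
  have bz: "2 *s (b \<star> z) = z + 2 *s (z \<star> z)"
    using ez by (subst bd) (simp only: star_add_left scale_right_distrib)
  have ba': "b \<star> a = \<beta> *s b + m *s odd_proj b a"
    using axis_mult[OF b, of a] by (simp add: assms)
  \<comment> \<open>Subtracting \<open>m *s (b \<star> a)\<close> from this cancels the odd
    component of \<open>a\<close> at \<open>b\<close> and leaves a multiple of
    \<open>b\<close>.\<close>
  have "b \<star> (b \<star> a) = \<beta> *s b + (m * m) *s odd_proj b a"
    unfolding ba' using pb(7) eigen_partD(1)[OF peirce_parts(2)[OF b]] by (simp add: star_simps)
  hence "b \<star> (b \<star> a) - m *s (b \<star> a) = (\<beta> * (1 - m)) *s b"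
    unfolding ba' by (simp add: algebra_simps)
  hence "2 *s (b \<star> (\<alpha> *s a + l *s z)) - (2 * m) *s (\<alpha> *s a + l *s z) = (2 * \<beta> * (1 - m)) *s b"
    unfolding ba by (metis (no_types, opaque_lifting) mult.assoc scale_right_diff_distrib scale_scale)
  moreover have "2 *s (b \<star> (\<alpha> *s a + l *s z)) = (2 * \<alpha>) *s (b \<star> a) + l *s (2 *s (b \<star> z))"
    by (simp add: star_simps algebra_simps)
  ultimately have E: "(2 * \<alpha>) *s (\<alpha> *s a + l *s z) + l *s (z + 2 *s (z \<star> z))
      - (2 * m) *s (\<alpha> *s a + l *s z) = (2 * \<beta> * (1 - m)) *s (\<alpha> *s a + y + z)"
    unfolding ba bz bd[symmetric] by simp
  have "(2 * l * \<alpha> + l - 2 * m * l) *s z = odd_proj a ((2 * \<alpha>) *s (\<alpha> *s a + l *s z)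
      + l *s (z + 2 *s (z \<star> z)) - (2 * m) *s (\<alpha> *s a + l *s z))"
    by (simp add: peirce_add peirce_scale peirce_diff A oz ow scale_left_distrib
        scale_left_diff_distrib mult.commute mult.left_commute)
  also have "\<dots> = (2 * \<beta> * (1 - m)) *s z"
    unfolding E by (simp add: peirce_add peirce_scale A oz)
  finally show 1: "2 * l * \<alpha> + l - 2 * m * l = 2 * \<beta> * (1 - m)"
    using nz by (simp add: z_def)
  have "2 *s (l *s (z \<star> z)) = (2 * \<beta> * (1 - m)) *s (\<alpha> *s a + y + z)
      - (2 * l * \<alpha> + l - 2 * m * l) *s z + (2 * m * \<alpha> - 2 * \<alpha> * \<alpha>) *s a"
    unfolding E[symmetric] by (simp add: algebra_simps)
  also have "\<dots> = 2 *s ((\<beta> * (1 - m) * \<alpha> - \<alpha> * \<alpha> + m * \<alpha>) *s a + (\<beta> * (1 - m)) *s y)"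
    unfolding 1 by (simp add: algebra_simps)
  finally show "l *s (z \<star> z) = (\<beta> * (1 - m) * \<alpha> - \<alpha> * \<alpha> + m * \<alpha>) *s a + (\<beta> * (1 - m)) *s y"
    using two_neq_0 by (simp only: scale_cancel_left) simp
qed

text \<open>Comparing this with the same formula for the pair \<open>b, a\<close> gives the equations that
  determine \<open>phi a b\<close> and \<open>phi b a\<close>.\<close>

lemma commutative_pair_square:
  assumes a: "primitive_axis l l a" and b: "primitive_axis m m b" and nz: "odd_proj a b \<noteq> 0"
  defines "\<alpha> \<equiv> phi a b" and "\<beta> \<equiv> phi b a"
  shows "(a \<star> b) \<star> (a \<star> b) =
    (\<alpha> * \<alpha> - 3 * l * \<alpha> * \<alpha> + l * m * \<alpha> + \<alpha> * \<beta> * (1 - m)) *s a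
    + (l * \<beta> * (1 - m)) *s b + (2 * \<alpha> * l - \<beta> * (1 - m)) *s (a \<star> b)"
proof -
  define y z where "y = null_proj a b" and "z = odd_proj a b"
  note pa = primitive_axis_parts[OF a]
  note rel = commutative_pair_relations[OF a b nz, folded \<alpha>_def \<beta>_def y_def z_def]
  have z: "z \<in> eigen_part l l a" and bd: "b = \<alpha> *s a + y + z"
    using peirce_parts[OF a, of b] by (simp_all add: assms y_def z_def)
  define e where "e = a \<star> b"
  have e: "e = \<alpha> *s a + l *s z"
    using axis_mult[OF a, of b] by (simp add: e_def assms z_def)
  \<comment> \<open>Both \<open>l *s z\<close> and \<open>l *s y\<close> are combinations of
    \<open>a\<close>, \<open>b\<close> and \<open>e\<close>, so \<open>y\<close> and
    \<open>z\<close> can be eliminated from \<open>e \<star> e\<close>.\<close>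
  hence lz: "l *s z = e - \<alpha> *s a" by simp
  have ly: "l *s y = l *s b - (l * \<alpha>) *s a - (e - \<alpha> *s a)"
    unfolding lz[symmetric] by (subst bd) (simp add: algebra_simps)
  have "e \<star> e = (\<alpha> * \<alpha>) *s a + (2 * \<alpha> * l) *s (l *s z) + l *s (l *s (z \<star> z))"
  proof -
    define v where "v = l *s z"
    have v: "a \<star> v = l *s v" "v \<star> a = l *s v" "v \<star> v = l *s (l *s (z \<star> z))"
      by (simp_all add: v_def star_simps eigen_partD[OF z])
    have "(2 * \<alpha> * l) *s v = (\<alpha> * l) *s v + (\<alpha> * l) *s v"
      by (simp only: scale_left_distrib[symmetric] mult_2 distrib_right)
    moreover have "e \<star> e = (\<alpha> * \<alpha>) *s a + ((\<alpha> * l) *s v + (\<alpha> * l) *s v) + v \<star> v"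
      unfolding e v_def[symmetric] by (simp add: star_simps v(1,2) pa(7) scale_right_distrib add.assoc)
    ultimately show ?thesis unfolding v(3)[symmetric] v_def by simp
  qed
  also have "l *s (l *s (z \<star> z)) = (l * (\<beta> * (1 - m) * \<alpha> - \<alpha> * \<alpha> + m * \<alpha>)) *s a + (\<beta> * (1 - m)) *s (l *s y)"
    unfolding rel(2) by (simp add: scale_right_distrib mult.commute)
  also note lz
  also note ly
  also have "(\<alpha> * \<alpha>) *s a + t *s (e - \<alpha> *s a) + (r *s a + k *s (l *s b - (l * \<alpha>) *s a - (e - \<alpha> *s a)))
      = (\<alpha> * \<alpha> - t * \<alpha> + r - k * (l * \<alpha>) + k * \<alpha>) *s a + (l * k) *s b + (t - k) *s e" for t r k
    by (simp add: algebra_simps)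
  also have "\<alpha> * \<alpha> - 2 * \<alpha> * l * \<alpha> + l * (\<beta> * (1 - m) * \<alpha> - \<alpha> * \<alpha> + m * \<alpha>)
      - \<beta> * (1 - m) * (l * \<alpha>) + \<beta> * (1 - m) * \<alpha>
      = \<alpha> * \<alpha> - 3 * l * \<alpha> * \<alpha> + l * m * \<alpha> + \<alpha> * \<beta> * (1 - m)"
    by (simp add: algebra_simps)
  finally show ?thesis
    unfolding e_def by (simp add: mult.assoc)
qed

text \<open>The vectors \<open>a\<close>, \<open>null_proj a b\<close>, \<open>odd_proj a b\<close>
  are eigenvectors of \<open>a\<close> for 1, 0 and \<open>l\<close>, and \<open>a\<close>,
  \<open>b\<close>, \<open>a \<star> b\<close> are triangular in them with nonzero diagonal.\<close>

lemma pair_independent: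
  assumes a: "primitive_axis l d a" and nz: "null_proj a b \<noteq> 0" "odd_proj a b \<noteq> 0"
    and eq: "p *s a + q *s b + r *s (a \<star> b) = p' *s a + q' *s b + r' *s (a \<star> b)"
  shows "p = p' \<and> q = q' \<and> r = r'"
proof -
  define y z where "y = null_proj a b" and "z = odd_proj a b"
  have y: "y \<in> null_part a" and z: "z \<in> eigen_part l d a" and bd: "b = phi a b *s a + y + z"
    using peirce_parts[OF a, of b] by (simp_all add: y_def z_def)
  define \<alpha> where "\<alpha> = phi a b"
  have ab: "a \<star> b = \<alpha> *s a + l *s z" using axis_mult(1)[OF a] by (simp add: \<alpha>_def z_def)
  note pa = primitive_axis_parts[OF a]
  have *: "p *s a + q *s b + r *s (a \<star> b) = (p + q * \<alpha> + r * \<alpha>) *s a + q *s y + (q + r * l) *s z" for p q r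
    unfolding ab by (subst bd) (simp add: \<alpha>_def algebra_simps)
  have "p + q * \<alpha> + r * \<alpha> = p' + q' * \<alpha> + r' * \<alpha> \<and> q *s y = q' *s y \<and> (q + r * l) *s z = (q' + r' * l) *s z"
    using pa(1,2)
    by (intro peirce_unique[OF pa(6,7) _ _ subspace_scale[OF subspace_null_part y]
        subspace_scale[OF subspace_null_part y] subspace_scale[OF subspace_eigen_part z]
        subspace_scale[OF subspace_eigen_part z] eq[unfolded *]]) auto
  thus ?thesis using nz pa(1) by (auto simp: y_def z_def)
qed

text \<open>The linear relations at \<open>a\<close> and at \<open>b\<close> settle the case
  \<open>l = m\<close>. For \<open>l \<noteq> m\<close> they are combined with the two expressions
  for the square of \<open>a \<star> b\<close>, whose coefficients are compared.\<close>

lemma commutative_pair: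
  assumes a: "primitive_axis l l a" and b: "primitive_axis m m b" and nz: "odd_proj a b \<noteq> 0"
  shows "l = m \<and> phi a b = phi b a \<or>
    l \<noteq> m \<and> l + m = 1 \<and> 2 * phi a b = 1 + m \<and> 2 * phi b a = 1 + l"
proof -
  define \<alpha> \<beta> where "\<alpha> = phi a b" and "\<beta> = phi b a"
  note pa = primitive_axis_parts[OF a] and pb = primitive_axis_parts[OF b]
  have nz': "odd_proj b a \<noteq> 0" using nz odd_proj_zero_sym[OF a b] by simp
  note rel = commutative_pair_relations[OF a b nz, folded \<alpha>_def \<beta>_def]
  note rel' = commutative_pair_relations[OF b a nz', folded \<alpha>_def \<beta>_def]
  note sq = commutative_pair_square[OF a b nz, folded \<alpha>_def \<beta>_def]
  note sq' = commutative_pair_square[OF b a nz', folded \<alpha>_def \<beta>_def]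
  note S = rel(1) rel'(1)
  have ab: "b \<star> a = a \<star> b" using commutative_axis_commutes[OF a, of b] by simp
  have "l = m \<and> \<alpha> = \<beta> \<or> l \<noteq> m \<and> l + m = 1 \<and> 2 * \<alpha> = 1 + m \<and> 2 * \<beta> = 1 + l"
  proof (cases "l = m")
    case True
    have "2 * (\<alpha> - \<beta>) = 0" using S unfolding True by algebra
    thus ?thesis using True two_neq_0 by simp
  next
    case lm: False
    show ?thesis
    proof (cases "null_proj a b = 0 \<and> null_proj b a = 0")
      \<comment> \<open>Now \<open>a\<close>, \<open>b\<close>, \<open>a \<star> b\<close> are
        dependent and no coefficients can be compared. Instead the relations give
        \<open>2 * l * m = 1\<close>, and then \<open>l = 1\<close>.\<close>
      case True
      have c1: "2 * \<alpha> * l = 1" using rel(3) nz True by (auto simp: star_simps)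
      have c2: "2 * \<beta> * m = 1" using rel'(3) nz' True by (auto simp: star_simps)
      define w where "w = odd_proj a b \<star> odd_proj a b"
      have "l *s w = (\<beta> * (1 - m) * \<alpha> - \<alpha> * \<alpha> + m * \<alpha>) *s a"
        using rel(2) True by (simp add: w_def)
      moreover have "w = (\<alpha> - \<alpha> * \<alpha>) *s a"
        using rel(4) True by (simp add: w_def star_simps algebra_simps)
      ultimately have "(l * (\<alpha> - \<alpha> * \<alpha>)) *s a = (\<beta> * (1 - m) * \<alpha> - \<alpha> * \<alpha> + m * \<alpha>) *s a"
        by simp
      hence c3: "l * (\<alpha> - \<alpha> * \<alpha>) = \<beta> * (1 - m) * \<alpha> - \<alpha> * \<alpha> + m * \<alpha>" using pa(6) by simp
      have "l + \<alpha> = \<beta> + m" using c1 c2 c3 by algebra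
      with c1 c2 have "(l - m) * (2 * l * m - 1) = 0" by algebra
      hence c4: "2 * l * m = 1" using lm by simp
      have "\<alpha> = m" "\<beta> = l" using c4 c1 c2 by algebra+
      hence "l = 2 * l - 2 * l * m" using S(1) by (simp add: algebra_simps)
      hence "l = 1" using c4 by simp
      thus ?thesis using pa(2) by simp
    next
      case False
      let ?P = "\<alpha> * \<alpha> - 3 * l * \<alpha> * \<alpha> + l * m * \<alpha> + \<alpha> * \<beta> * (1 - m)" and ?Q = "l * \<beta> * (1 - m)"
      let ?P' = "\<beta> * \<beta> - 3 * m * \<beta> * \<beta> + m * l * \<beta> + \<beta> * \<alpha> * (1 - l)" and ?Q' = "m * \<alpha> * (1 - l)"
      have eq: "?P *s a + ?Q *s b + (2 * \<alpha> * l - \<beta> * (1 - m)) *s (a \<star> b) =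
          ?Q' *s a + ?P' *s b + (2 * \<beta> * m - \<alpha> * (1 - l)) *s (a \<star> b)"
        using trans[OF sq[symmetric] sq'[unfolded ab]] by (simp only: add.commute[of "?P' *s b"])
      \<comment> \<open>A nonzero null component at either axis allows the comparison of
        coefficients; the roles of \<open>a\<close> and \<open>b\<close> are exchanged if
        necessary.\<close>
      have "?P = ?Q' \<and> ?Q = ?P'"
      proof (cases "null_proj a b = 0")
        case True
        with False have "null_proj b a \<noteq> 0" by simp
        have "?Q *s b + ?P *s a + (2 * \<alpha> * l - \<beta> * (1 - m)) *s (b \<star> a) =
          ?P' *s b + ?Q' *s a + (2 * \<beta> * m - \<alpha> * (1 - l)) *s (b \<star> a)"
          using eq unfolding ab by (simp only: add.commute[of "_ *s b" "_ *s a"])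
        from pair_independent[OF b \<open>null_proj b a \<noteq> 0\<close> nz' this] show ?thesis by blast
      next
        case False
        from pair_independent[OF a this nz eq] show ?thesis by blast
      qed
      hence PQ: "?Q' = ?P" "?Q = ?P'" by simp_all
      show ?thesis
      proof (cases "l + m = 1")
        case False
        \<comment> \<open>Off \<open>l + m = 1\<close> the linear system determines both values, and
          \<open>?Q = ?P'\<close> then gives \<open>l * (l - m) = 0\<close>.\<close>
        have "(1 - l - m) * (2 * \<alpha> - m) = 0" "(1 - l - m) * (2 * \<beta> - l) = 0"
          using S by algebra+
        moreover have "1 - l - m \<noteq> 0" using False by (simp add: diff_diff_eq)
        ultimately have h: "2 * \<alpha> = m" "2 * \<beta> = l" by simp_all
        have "l * (l - m) = 4 * (?Q - ?P')"
          unfolding h[symmetric] by (simp add: algebra_simps)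
        thus ?thesis using lm pa(1) PQ(2) by simp
      next
        case True
        hence m: "m = 1 - l" by (simp add: algebra_simps)
        \<comment> \<open>For \<open>l + m = 1\<close> the two linear equations coincide and fix
          only the difference of the unknowns; the quadratic ones supply the rest.\<close>
        have "l * (2 * \<alpha> - 2 * \<beta> - (m - l)) = 0"
          using S(1) unfolding m by (simp add: algebra_simps)
        hence "2 * \<alpha> - 2 * \<beta> - (m - l) = 0" using pa(1) by simp
        hence d: "2 * \<alpha> = 2 * \<beta> + m - l" by algebra
        have "\<beta> * ((m - l) * (2 * \<beta> - 1 - l)) = 0" using d m PQ(2) by algebra
        hence c1: "\<beta> = 0 \<or> 2 * \<beta> = 1 + l" using lm by (simp add: diff_diff_eq)
        have "\<alpha> * ((m - l) * (2 * \<alpha> - 1 - m)) = 0" using d m PQ(1) by algebra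
        hence c2: "\<alpha> = 0 \<or> 2 * \<alpha> = 1 + m" using lm by (simp add: diff_diff_eq)
        \<comment> \<open>Both unknowns cannot vanish, as \<open>l \<noteq> m\<close>. If just one
          does, \<open>d\<close> still yields the asserted values, with \<open>1 + m\<close> or
          \<open>1 + l\<close> being zero.\<close>
        have "2 * \<alpha> = 1 + m \<and> 2 * \<beta> = 1 + l"
          using c1 c2
        proof (elim disjE)
          assume "\<alpha> = 0" "\<beta> = 0"
          thus ?thesis using d lm by simp
        next
          assume "2 * \<alpha> = 1 + m"
          thus ?thesis using d by (simp add: eq_diff_eq diff_eq_eq)
        qed (use d in simp_all)
        thus ?thesis using lm True by simp
      qed
    qed
  qed
  thus ?thesis by (simp add: \<alpha>_def \<beta>_def)
qed

lemma phi_sym_or_complementary: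
  assumes "a \<in> primitive_axes" "b \<in> primitive_axes"
  shows "phi a b = phi b a \<or>
    (\<exists>l. l \<noteq> 1 - l \<and> primitive_axis l l a \<and> primitive_axis (1 - l) (1 - l) b \<and> odd_proj a b \<noteq> 0)"
proof -
  obtain l d m n where a: "primitive_axis l d a" and b: "primitive_axis m n b"
    using assms by (auto simp: primitive_axes_def)
  consider "l \<noteq> d" | "m \<noteq> n" | "odd_proj a b = 0" | "l = d" "m = n" "odd_proj a b \<noteq> 0" by blast
  thus ?thesis
  proof cases
    case 1
    thus ?thesis using noncommutative_phi(1)[OF a b] by simp
  next
    case 2
    thus ?thesis using noncommutative_phi(1)[OF b a] by simp
  next
    case 3
    thus ?thesis using odd_proj_zero_cases[OF a b] by auto
  next
    case 4
    have "m = 1 - l" if "l + m = 1" using that by (simp add: eq_diff_eq add.commute)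
    thus ?thesis using commutative_pair[OF a[folded 4(1)] b[folded 4(2)] 4(3)] a b 4 by auto
  qed
qed

subsection \<open>The Frobenius form\<close>

text \<open>Extend \<open>f\<close> linearly in its index from a basis \<open>S\<close> inside
  \<open>G\<close>. Symmetry gives \<open>B u c = f c u\<close> first for \<open>u\<close> in
  \<open>S\<close>, hence for all \<open>u\<close>. A second use of symmetry, with \<open>u\<close>
  running through \<open>G\<close>, gives \<open>B c u = f c u\<close> even for \<open>c\<close>
  outside \<open>S\<close>.\<close>

lemma bilinear_form_of_functionals:
  assumes span: "span G = UNIV"
    and add: "\<And>c u v. c \<in> G \<Longrightarrow> f c (u + v) = f c u + f c v"
    and scale: "\<And>c r u. c \<in> G \<Longrightarrow> f c (r *s u) = r * f c u"
    and sym: "\<And>c c'. c \<in> G \<Longrightarrow> c' \<in> G \<Longrightarrow> f c c' = f c' c"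
  shows "\<exists>B :: 'a \<Rightarrow> 'a \<Rightarrow> 'f.
    (\<forall>u v w. B (u + v) w = B u w + B v w) \<and> (\<forall>r u w. B (r *s u) w = r * B u w) \<and>
    (\<forall>u v w. B w (u + v) = B w u + B w v) \<and> (\<forall>r u w. B w (r *s u) = r * B w u) \<and>
    (\<forall>c\<in>G. \<forall>u. B c u = f c u \<and> B u c = f c u)"
proof -
  interpret vf: vector_space "(*) :: 'f \<Rightarrow> 'f \<Rightarrow> 'f"
    by unfold_locales (simp_all add: algebra_simps)
  interpret p: vector_space_pair scale "(*) :: 'f \<Rightarrow> 'f \<Rightarrow> 'f" ..
  obtain S where S: "S \<subseteq> G" "independent S" "G \<subseteq> span S"
    using maximal_independent_subset by blast
  have spanS: "span S = UNIV" using span span_mono[OF S(3)] by (simp add: span_span top.extremum_unique)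
  define B where "B u v = p.construct S (\<lambda>c. f c v) u" for u v
  have lin: "Vector_Spaces.linear scale (*) (\<lambda>u. B u v)" for v
    unfolding B_def using p.linear_construct[OF S(2)] .
  have L: "B (u + v) w = B u w + B v w" "B (r *s u) w = r * B u w" for u v w r
    using lin[of w] by (simp_all add: Vector_Spaces.linear_iff)
  have BS: "B c u = f c u" if "c \<in> S" for c u
    unfolding B_def using p.construct_basis[OF S(2) that] .
  have ind: "P u" if "P 0" "\<And>r c u. c \<in> T \<Longrightarrow> P u \<Longrightarrow> P (r *s c + u)" "span T = UNIV" for P u T
    using span_induct_alt[of u T P] that by auto
  have B0: "B 0 w = 0" for w using L(2)[of 0 0 w] by simp
  have f0: "f c 0 = 0" if "c \<in> G" for c using scale[OF that, of 0 0] by simp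
  have R: "B w (u + v) = B w u + B w v" for u v w
    by (rule ind[of "\<lambda>w. B w (u + v) = B w u + B w v" S])
      (use spanS add S(1) in \<open>auto simp: L B0 BS algebra_simps subset_iff\<close>)
  have R': "B w (r *s u) = r * B w u" for u w r
  proof (rule ind[of "\<lambda>w. B w (r *s u) = r * B w u" S])
    show "B (s *s c + w) (r *s u) = r * B (s *s c + w) u"
      if "c \<in> S" "B w (r *s u) = r * B w u" for s c w
      using that S(1) scale[of c r u] by (auto simp: L BS distrib_left)
  qed (simp_all add: B0 spanS)
  have C: "B u c = f c u" if c: "c \<in> G" for c u
  proof (rule ind[of "\<lambda>u. B u c = f c u" S])
    show "B (r *s c' + u) c = f c (r *s c' + u)" if "c' \<in> S" "B u c = f c u" for r c' u
      using that c S(1) sym[of c c'] by (auto simp: L BS add scale)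
  qed (use spanS c f0 in \<open>simp_all add: B0\<close>)
  have D: "B c u = f c u" if c: "c \<in> G" for c u
  proof (rule ind[of "\<lambda>u. B c u = f c u" G])
    show "B c (r *s c' + u) = f c (r *s c' + u)" if "c' \<in> G" "B c u = f c u" for r c' u
      using that c sym[of c c'] by (auto simp: R R' C add scale)
    show "B c 0 = f c 0" using R'[of c 0 0] c f0 by simp
  qed (use span in simp)
  show ?thesis by (rule exI[of _ B]) (simp add: L R R' C D)
qed

text \<open>Associativity of the form only has to be checked for a middle factor that is an axis \<open>a\<close>;
  there it says that the Peirce components of \<open>a\<close> are orthogonal, which is invariance under
  \<open>miy a\<close>, and that the odd component is isotropic if \<open>a\<close> is noncommutative.\<close>

lemma frobenius_form_exists:
  assumes G: "G \<subseteq> primitive_axes" "span G = UNIV" "G \<noteq> {}"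
    and inv: "\<And>x y. x \<in> G \<Longrightarrow> y \<in> G \<Longrightarrow> miy x y \<in> G"
    and sym: "\<And>x y. x \<in> G \<Longrightarrow> y \<in> G \<Longrightarrow> phi x y = phi y x"
  shows "\<exists>B. frobenius_form B \<and> (\<forall>x\<in>G. B x x = 1)"
proof -
  have GP: "c \<in> primitive_axes" if "c \<in> G" for c using that G(1) by blast
  obtain B where L: "\<And>u v w. B (u + v) w = B u w + B v w" "\<And>r u w. B (r *s u) w = r * B u w"
    and R: "\<And>u v w. B w (u + v) = B w u + B w v" "\<And>r u w. B w (r *s u) = r * B w u"
    and C: "\<And>c u. c \<in> G \<Longrightarrow> B c u = phi c u" "\<And>c u. c \<in> G \<Longrightarrow> B u c = phi c u"
    using bilinear_form_of_functionals[of G phi, OF G(2) peirce_add(1)[OF GP] peirce_scale(1)[OF GP] sym]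
    by blast
  have Z: "B 0 w = 0" "B w 0 = 0" for w using L(2)[of 0 0 w] R(2)[of w 0 0] by simp_all
  have M: "B (- u) w = - B u w" "B w (- u) = - B w u" for u w
    using L(2)[of "-1" u w] R(2)[of w "-1" u] by simp_all
  have Df: "B (u - v) w = B u w - B v w" "B w (u - v) = B w u - B w v" for u v w
    using L(1)[of u "- v" w] R(1)[of w u "- v"] by (simp_all add: M)
  have ind: "P u" if "P 0" "\<And>r c u. c \<in> G \<Longrightarrow> P u \<Longrightarrow> P (r *s c + u)" for P u
    using span_induct_alt[of u G P] that G(2) by auto
  \<comment> \<open>For \<open>u = c\<close> in \<open>G\<close> this reads
    \<open>phi (miy a c) (miy a v) = phi c v\<close>, because \<open>miy a c\<close> lies in
    \<open>G\<close> again.\<close>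
  have miy_inv: "B (miy a u) (miy a v) = B u v" if a: "a \<in> G" for a u v
  proof -
    note i = involution_miy[OF GP[OF a]]
    note gs = involutionD[OF i]
    show ?thesis
    proof (rule ind[of "\<lambda>u. B (miy a u) (miy a v) = B u v"])
      show "B (miy a (r *s c + u)) (miy a v) = B (r *s c + u) v"
        if "c \<in> G" "B (miy a u) (miy a v) = B u v" for r c u
        using that inv[OF a] peirce_involution(1)[OF i GP] by (simp add: gs L C)
    qed (simp add: gs Z)
  qed
  have orth: "B (u - odd_proj a u) (odd_proj a v) = 0" "B (odd_proj a v) (u - odd_proj a u) = 0"
    if a: "a \<in> G" for a u v
  proof -
    \<comment> \<open>By invariance each of the two form values equals its own negative.\<close>
    have 1: "miy a (u - odd_proj a u) = u - odd_proj a u" "miy a (odd_proj a v) = - odd_proj a v"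
      by (simp_all add: miy_def peirce_simps GP[OF a])
    have zero: "x = 0" if "- x = x" for x :: 'f
    proof -
      have "2 * x = 0" using that by (metis add.right_inverse mult_2)
      thus ?thesis using two_neq_0 by simp
    qed
    show "B (u - odd_proj a u) (odd_proj a v) = 0" "B (odd_proj a v) (u - odd_proj a u) = 0"
      using miy_inv[OF a, of "u - odd_proj a u" "odd_proj a v"]
        miy_inv[OF a, of "odd_proj a v" "u - odd_proj a u"] zero
      unfolding 1 M by blast+
  qed
  have axis_assoc: "B x (a \<star> z) = B (x \<star> a) z" if a: "a \<in> G" for a x z
  proof -
    obtain l d where ld: "primitive_axis l d a" using GP[OF a] by (auto simp: primitive_axes_def)
    have "B x (odd_proj a z) = B (odd_proj a x) (odd_proj a z)"
      using orth(1)[OF a, of x z] by (simp add: Df)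
    moreover have "B (odd_proj a x) z = B (odd_proj a x) (odd_proj a z)"
      using orth(2)[OF a, of x z] by (simp add: Df)
    \<comment> \<open>The two sides of the claim weight this term by \<open>l\<close> and
      \<open>d\<close>. As \<open>G\<close> spans, its vanishing for \<open>l \<noteq> d\<close>
      reduces to \<open>noncommutative_odd_radical_axis\<close> for members of
      \<open>G\<close>.\<close>
    moreover have "B (odd_proj a x) (odd_proj a z) = 0" if "l \<noteq> d"
    proof (rule ind[of "\<lambda>u. B u (odd_proj a z) = 0"])
      have "phi c (odd_proj a z) = 0" if "c \<in> G" for c
        by (rule ind[of "\<lambda>z. phi c (odd_proj a z) = 0"])
          (simp_all add: peirce_simps GP a that noncommutative_odd_radical_axis[OF ld \<open>l \<noteq> d\<close>])
      thus "B (r *s c + u) (odd_proj a z) = 0" if "c \<in> G" "B u (odd_proj a z) = 0" for r c u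
        using that by (simp add: L C)
    qed (simp add: Z)
    ultimately show ?thesis
      by (cases "l = d") (simp_all add: axis_mult[OF ld] L R C a mult.commute)
  qed
  have assoc: "B x (y \<star> z) = B (x \<star> y) z" for x y z
    by (rule ind[of "\<lambda>y. B x (y \<star> z) = B (x \<star> y) z"]) (simp_all add: star_simps Z L R axis_assoc)
  obtain c where "c \<in> G" using G(3) by blast
  have self: "B x x = 1" if "x \<in> G" for x using that GP by (simp add: C peirce_self)
  interpret vf: vector_space "(*) :: 'f \<Rightarrow> 'f \<Rightarrow> 'f"
    by unfold_locales (simp_all add: algebra_simps)
  have "frobenius_form B"
    unfolding frobenius_form_def Vector_Spaces.linear_iff
    using L R assoc self[OF \<open>c \<in> G\<close>] vector_space_axioms vf.vector_space_axioms
    by (metis zero_neq_one)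
  thus ?thesis using self by blast
qed

subsection \<open>Choice of the generating set\<close>

text \<open>Since \<open>2 * phi b a = 1 + l\<close> is nonzero, the two expansions of
  \<open>a \<star> b\<close> can be solved for \<open>b\<close>. Both odd components in them are
  half differences of the three listed vectors: \<open>w\<close> of the first two, \<open>z\<close>
  of the last two.\<close>

lemma complementary_axis_in_span:
  assumes a: "primitive_axis l l a" and b: "primitive_axis (1 - l) (1 - l) b"
    and l: "l \<noteq> 1 - l" "l \<noteq> - 1" and nz: "odd_proj a b \<noteq> 0"
  shows "b \<in> span {a, miy b a, miy a (miy b a)}"
proof -
  have A: "a \<in> primitive_axes" using a by (rule primitive_axesI)
  define m where "m = 1 - l"
  define w z where "w = odd_proj b a" and "z = odd_proj a b"
  have b': "primitive_axis m m b" using b by (simp add: m_def)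
  note pb = primitive_axis_parts[OF b']
  have \<beta>: "2 * phi b a = 1 + l" using commutative_pair[OF a b' nz] l(1) by (auto simp: m_def)
  have "1 + l \<noteq> 0" using l(2) by (metis add.commute eq_neg_iff_add_eq_0)
  hence \<beta>0: "phi b a \<noteq> 0" using \<beta> by auto
  have e: "phi a b *s a + l *s z = phi b a *s b + m *s w"
    using axis_mult(1)[OF a, of b] axis_mult(2)[OF b', of a] by (simp add: w_def z_def)
  have "l *s z = phi b a *s z + m *s odd_proj a w"
    using arg_cong[OF e, of "odd_proj a"] by (simp add: peirce_simps A z_def)
  hence mw: "m *s odd_proj a w = (l - phi b a) *s z" by (simp add: scale_left_diff_distrib)
  have "m *s odd_proj a (miy b a) = - (m *s odd_proj a w + m *s odd_proj a w)"
    by (simp add: miy_def peirce_simps A scale_right_diff_distrib flip: w_def)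
  also have "\<dots> = (- ((l - phi b a) + (l - phi b a))) *s z"
    unfolding mw by (simp only: scale_left_distrib scale_minus_left)
  \<comment> \<open>The value \<open>2 * phi b a = 1 + l\<close> turns the coefficient into
    \<open>1 - l\<close>, which makes the odd part of \<open>miy b a\<close> exactly
    \<open>z\<close>.\<close>
  also have "- ((l - phi b a) + (l - phi b a)) = m" using \<beta> m_def by algebra
  finally have od: "odd_proj a (miy b a) = z" using pb(1) by simp
  let ?S = "span {a, miy b a, miy a (miy b a)}"
  have S: "a \<in> ?S" "miy b a \<in> ?S" "miy a (miy b a) \<in> ?S" by (auto intro: span_base)
  have "z + z = miy b a - miy a (miy b a)" unfolding miy_def[of a] od by simp
  from eq_scale_half[OF this] have z: "z \<in> ?S" using S by (metis span_diff span_scale)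
  have "w + w = a - miy b a" by (simp add: miy_def w_def)
  from eq_scale_half[OF this] have w: "w \<in> ?S" using S by (metis span_diff span_scale)
  have "phi b a *s b = phi a b *s a + l *s z - m *s w" using e by simp
  hence "phi b a *s b \<in> ?S" using S(1) z w by (auto intro!: span_diff span_add span_scale)
  hence "inverse (phi b a) *s (phi b a *s b) \<in> ?S" by (rule span_scale)
  thus ?thesis using \<beta>0 by simp
qed

text \<open>\<open>P\<close> is the set of preferred types.\<close>

definition good_axes :: "'f set \<Rightarrow> 'a set" where
  "good_axes P = {x \<in> primitive_axes. \<forall>l y. l \<in> P \<longrightarrow> 1 - l \<notin> P \<longrightarrow>
     primitive_axis (1 - l) (1 - l) x \<longrightarrow> primitive_axis l l y \<longrightarrow> odd_proj x y = 0}"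

lemma good_axes_primitive: "good_axes P \<subseteq> primitive_axes"
  by (auto simp: good_axes_def)

text \<open>\<open>miy x\<close> preserves types, so it carries a partner excluding
  \<open>miy x y\<close> to one that would exclude \<open>y\<close>.\<close>

lemma good_axes_miy:
  assumes "x \<in> good_axes P" "y \<in> good_axes P"
  shows "miy x y \<in> good_axes P"
proof -
  have xy: "x \<in> primitive_axes" "y \<in> primitive_axes" using assms good_axes_primitive by blast+
  note i = involution_miy[OF xy(1)]
  note g = involutionD[OF i] and pi = primitive_axis_involution[OF i]
  have "odd_proj (miy x y) u = 0"
    if "l \<in> P" "1 - l \<notin> P" "primitive_axis (1 - l) (1 - l) (miy x y)" "primitive_axis l l u" for l u
  proof -
    have "odd_proj y (miy x u) = 0"
      using that pi[OF that(3)] pi[OF that(4)] assms(2) by (auto simp: good_axes_def g(4))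
    thus ?thesis using peirce_involution(2)[OF i xy(2), of "miy x u"] by (simp add: g)
  qed
  thus ?thesis using primitive_axes_involution[OF i xy(2)] by (auto simp: good_axes_def)
qed

text \<open>Asymmetry requires complementary types and a nonzero odd component; exactly one of the
  two types is preferred, so the axis of the other type has been discarded.\<close>

lemma good_axes_phi_sym:
  assumes P: "\<And>l. l \<noteq> 1 - l \<Longrightarrow> l \<in> P \<longleftrightarrow> 1 - l \<notin> P"
    and x: "x \<in> good_axes P" and y: "y \<in> good_axes P"
  shows "phi x y = phi y x"
proof (rule ccontr)
  have xy: "x \<in> primitive_axes" "y \<in> primitive_axes" using assms good_axes_primitive by blast+
  assume "phi x y \<noteq> phi y x"
  then obtain l where l: "l \<noteq> 1 - l" "primitive_axis l l x" "primitive_axis (1 - l) (1 - l) y"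
      "odd_proj x y \<noteq> 0"
    using phi_sym_or_complementary[OF xy] by blast
  hence nz: "odd_proj y x \<noteq> 0" using odd_proj_zero_sym by blast
  show False
  proof (cases "l \<in> P")
    case True
    thus False using P[OF l(1)] y l nz by (auto simp: good_axes_def)
  next
    case False
    hence "1 - l \<in> P" "1 - (1 - l) \<notin> P" "primitive_axis (1 - (1 - l)) (1 - (1 - l)) x"
      using P[OF l(1)] l by auto
    thus False using x l(3,4) unfolding good_axes_def by blast
  qed
qed

lemma not_good_axisE:
  assumes "x \<in> primitive_axes" "x \<notin> good_axes P"
  obtains l y where "l \<in> P" "1 - l \<notin> P" "primitive_axis (1 - l) (1 - l) x" "primitive_axis l l y"
    "odd_proj x y \<noteq> 0" "odd_proj y x \<noteq> 0"
  using assms odd_proj_zero_sym unfolding good_axes_def by blast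

text \<open>A discarded generator \<open>x\<close> has a partner \<open>y\<close> of preferred type.
  Both \<open>y\<close> and \<open>miy x y\<close> are good, and
  \<open>complementary_axis_in_span\<close> recovers \<open>x\<close> from them.\<close>

lemma span_good_axes:
  assumes X: "X \<subseteq> primitive_axes" "generates X"
    and P: "\<And>l. l \<noteq> 1 - l \<Longrightarrow> l \<in> P \<longleftrightarrow> 1 - l \<notin> P" "(2::'f) \<noteq> - 1 \<Longrightarrow> 2 \<in> P"
  shows "span (good_axes P) = UNIV"
proof -
  have "x \<in> span (good_axes P)" if "x \<in> X" for x
  proof (cases "x \<in> good_axes P")
    case True
    thus ?thesis by (rule span_base)
  next
    case False
    have "x \<in> primitive_axes" using X(1) that by blast
    then obtain l y where ly: "l \<in> P" "1 - l \<notin> P" "primitive_axis (1 - l) (1 - l) x"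
        "primitive_axis l l y" "odd_proj x y \<noteq> 0" "odd_proj y x \<noteq> 0"
      using False by (rule not_good_axisE)
    have l1: "l \<noteq> 1 - l" using ly(1,2) by metis
    \<comment> \<open>The complement of -1 is 2, which is preferred unless \<open>2 = - 1\<close>;
      in that case \<open>l\<close> would be its own complement.\<close>
    have l2: "l \<noteq> - 1"
    proof
      assume l: "l = - 1"
      hence "1 - l = 2" by simp
      thus False using ly(2) l1 P(2) l by auto
    qed
    \<comment> \<open>A nonzero odd component fixes the type, so \<open>v\<close> cannot also have a
      type that is not preferred.\<close>
    have good: "v \<in> good_axes P" if v: "primitive_axis l l v" "odd_proj v u \<noteq> 0" for u v
    proof (rule ccontr)
      assume "v \<notin> good_axes P"
      with primitive_axesI[OF v(1)] obtain k where "k \<in> P" "1 - k \<notin> P" "primitive_axis (1 - k) (1 - k) v"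
        by (rule not_good_axisE)
      moreover from primitive_axis_type_unique(1)[OF v(1) this(3) v(2)] have "k = 1 - l" by simp
      ultimately show False using ly(2) by simp
    qed
    note ix = involution_miy[OF \<open>x \<in> primitive_axes\<close>]
    have y: "y \<in> good_axes P" using good ly(4,6) by blast
    have "odd_proj (miy x y) (miy x x) = miy x (odd_proj y x)"
      using peirce_involution(2)[OF ix] primitive_axesI[OF ly(4)] by blast
    hence "odd_proj (miy x y) (miy x x) \<noteq> 0" using ly(6) involutionD(4,5)[OF ix] by metis
    hence d: "miy x y \<in> good_axes P" using good primitive_axis_involution[OF ix ly(4)] by blast
    have "{y, miy x y, miy y (miy x y)} \<subseteq> good_axes P" using y d good_axes_miy by blast
    thus ?thesis
      using complementary_axis_in_span[OF ly(4,3) l1 l2 ly(6)] span_mono by blast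
  qed
  hence "X \<subseteq> span (good_axes P)" by blast
  moreover have "subalgebra (span (good_axes P))"
    by (rule subalgebra_span_axes[OF good_axes_primitive good_axes_miy])
  ultimately show ?thesis
    using X(2) hull_minimal[of X "span (good_axes P)" subalgebra] by (auto simp: generates_def)
qed

lemma good_axes_normalised:
  assumes X: "X \<subseteq> primitive_axes" "generates X" "X \<noteq> {}"
    and P: "\<And>l. l \<noteq> 1 - l \<Longrightarrow> l \<in> P \<longleftrightarrow> 1 - l \<notin> P" "(2::'f) \<noteq> - 1 \<Longrightarrow> 2 \<in> P"
  shows "\<exists>B. normalised_axes (good_axes P) B"
proof -
  note span = span_good_axes[OF X(1,2) P]
  obtain c where "c \<in> primitive_axes" using X by blast
  hence c: "c \<noteq> 0" by (auto simp: primitive_axes_def dest: primitive_axis_parts(6))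
  have "good_axes P \<noteq> {}"
  proof
    assume "good_axes P = {}"
    thus False using span c by auto
  qed
  then obtain B where "frobenius_form B" "\<forall>x\<in>good_axes P. B x x = 1"
    using frobenius_form_exists[OF good_axes_primitive span _ good_axes_miy good_axes_phi_sym[OF P(1)]]
    by blast
  moreover have "generates (good_axes P)"
  proof -
    have "span (good_axes P) \<subseteq> S" if "good_axes P \<subseteq> S" "subalgebra S" for S
      using that by (auto simp: subalgebra_def intro: span_minimal[THEN subsetD])
    thus ?thesis using span by (auto simp: generates_def hull_def)
  qed
  ultimately show ?thesis using good_axes_primitive by (auto simp: normalised_axes_def)
qed

text \<open>From each pair \<open>{l, 1 - l}\<close> pick 2 if present, else \<open>c\<close>, else
  anything. The choices 2 and \<open>c\<close> compete only for \<open>2 = 1 - c\<close>, that is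
  \<open>c = - 1\<close>.\<close>

lemma type_representatives:
  fixes c :: 'f
  assumes "c \<noteq> - 1"
  obtains P where "\<And>l. l \<noteq> 1 - l \<Longrightarrow> l \<in> P \<longleftrightarrow> 1 - l \<notin> P" "(2::'f) \<noteq> - 1 \<Longrightarrow> 2 \<in> P"
    "c \<noteq> 1 - c \<Longrightarrow> c \<in> P"
proof -
  define r where "r S = (if 2 \<in> S then 2 else if c \<in> S then c else SOME x. x \<in> S)" for S
  define P where "P = {l. r {l, 1 - l} = l}"
  have r: "r S \<in> S" if "S \<noteq> {}" for S using that by (auto simp: r_def some_in_eq)
  have "l \<in> P \<longleftrightarrow> 1 - l \<notin> P" if "l \<noteq> 1 - l" for l
  proof -
    have "{1 - l, 1 - (1 - l)} = {l, 1 - l}" by auto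
    thus ?thesis using r[of "{l, 1 - l}"] that by (auto simp: P_def)
  qed
  moreover have "2 \<in> P" by (simp add: P_def r_def)
  moreover have "c \<in> P"
  proof -
    have "c = - 1" if "2 = 1 - c" using that by algebra
    thus ?thesis using assms by (auto simp: P_def r_def)
  qed
  ultimately show thesis using that by blast
qed

section \<open>Frobenius forms at axes and the radical\<close>

text \<open>Associativity with \<open>a \<star> a = a\<close> makes the null and odd components
  orthogonal to \<open>a\<close> on both sides, as neither 0 nor \<open>l\<close> nor
  \<open>d\<close> equals 1.\<close>

lemma frobenius_form_axis:
  assumes B: "frobenius_form B" and a: "primitive_axis l d a"
  shows "B a u = phi a u * B a a" "B u a = phi a u * B a a"
proof -
  have L: "B (u + v) w = B u w + B v w" "B (r *s u) w = r * B u w"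
    and R: "B w (u + v) = B w u + B w v" "B w (r *s u) = r * B w u"
    and as: "B u (v \<star> w) = B (u \<star> v) w" for u v w r
    using B by (auto simp: frobenius_form_def Vector_Spaces.linear_iff)
  note p = primitive_axis_parts[OF a] and q = peirce_parts[OF a, of u]
  have Z: "B 0 w = 0" "B w 0 = 0" for w using L(2)[of 0 0 w] R(2)[of w 0 0] by simp_all
  have "B a (null_proj a u) = 0" "B (null_proj a u) a = 0"
    using as[of a a "null_proj a u"] as[of "null_proj a u" a a] null_partD[OF q(1)]
    by (simp_all add: p(7) Z)
  moreover have "B a (odd_proj a u) = l * B a (odd_proj a u)" "B (odd_proj a u) a = d * B (odd_proj a u) a"
    using as[of a a "odd_proj a u"] as[of "odd_proj a u" a a] eigen_partD[OF q(2)]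
    by (simp_all add: p(7) L R)
  hence "B a (odd_proj a u) = 0" "B (odd_proj a u) a = 0" using p(2,4) by simp_all
  ultimately show "B a u = phi a u * B a a" "B u a = phi a u * B a a"
    by (subst q(3); simp add: L R)+
qed

text \<open>Evaluating \<open>B a b\<close> at each axis gives
  \<open>phi a b * B a a = phi b a * B b b\<close>, where \<open>phi b a = 0\<close> and
  \<open>2 * phi a b = 3\<close> is nonzero. So \<open>B a a = 0\<close>, and every
  \<open>B a u\<close> is a multiple of it.\<close>

lemma axis_in_radical:
  assumes a: "primitive_axis (- 1) (- 1) a" and b: "primitive_axis 2 2 b"
    and nz: "odd_proj a b \<noteq> 0" and c3: "(2::'f) \<noteq> - 1" and B: "frobenius_form B"
  shows "a \<in> form_radical B"
proof -
  have pr: "2 * phi a b = 1 + 2" "2 * phi b a = 0"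
    using commutative_pair[OF a b nz] c3 by auto
  have "(1 + 2 :: 'f) \<noteq> 0" using c3 by (metis add.commute eq_neg_iff_add_eq_0)
  hence \<alpha>: "phi a b \<noteq> 0" "phi b a = 0" using pr two_neq_0 by auto
  have "phi a b * B a a = phi b a * B b b"
    using frobenius_form_axis(1)[OF B a, of b] frobenius_form_axis(2)[OF B b, of a] by simp
  hence "B a a = 0" using \<alpha> by simp
  hence "B a u = 0" for u by (subst frobenius_form_axis(1)[OF B a]) simp
  thus ?thesis by (simp add: form_radical_def)
qed

lemma normalised_axes_or_radical:
  assumes \<tau>: "type_function \<tau>" and X: "X \<subseteq> primitive_axes" "generates X" and a: "a \<in> X"
  shows "(\<exists>X' B. normalised_axes X' B) \<and>
    ((\<exists>X' B. normalised_axes X' B \<and> a \<in> X') \<or>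
     (\<tau> a = (-1, -1) \<and> (\<exists>b \<in> primitive_axes. \<tau> b = (2, 2) \<and> a \<star> b \<noteq> 0) \<and>
      (\<forall>B. frobenius_form B \<longrightarrow> a \<in> form_radical B)))"
proof -
  have \<tau>D: "primitive_axis (fst (\<tau> x)) (snd (\<tau> x)) x" if "x \<in> primitive_axes" for x
    using \<tau> that by (simp add: type_function_def)
  have \<tau>_eq: "\<tau> x = (l, l)" if "primitive_axis l l x" "odd_proj x u \<noteq> 0" for x l u
    using primitive_axis_type_unique[OF \<tau>D[OF primitive_axesI[OF that(1)]] that]
    by (simp add: prod_eq_iff)
  have aP: "a \<in> primitive_axes" using a X(1) by blast
  \<comment> \<open>Preferring the type of \<open>a\<close> keeps \<open>a\<close> good, but -1 must
    not displace 2. The default 0 is harmless, since neither 0 nor its complement 1 is a type of an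
    axis.\<close>
  define c where "c = (if fst (\<tau> a) = - 1 then 0 else fst (\<tau> a))"
  have "c \<noteq> - 1" by (simp add: c_def)
  then obtain P where P: "\<And>l. l \<noteq> 1 - l \<Longrightarrow> l \<in> P \<longleftrightarrow> 1 - l \<notin> P" "(2::'f) \<noteq> - 1 \<Longrightarrow> 2 \<in> P"
      "c \<noteq> 1 - c \<Longrightarrow> c \<in> P"
    by (rule type_representatives) blast
  have "X \<noteq> {}" using a by blast
  obtain B where N: "normalised_axes (good_axes P) B"
    using good_axes_normalised[OF X \<open>X \<noteq> {}\<close> P(1,2)] by blast
  show ?thesis
  proof (cases "a \<in> good_axes P")
    case True
    thus ?thesis using N by blast
  next
    case False
    with aP obtain l y where ly: "l \<in> P" "1 - l \<notin> P" "primitive_axis (1 - l) (1 - l) a"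
        "primitive_axis l l y" "odd_proj a y \<noteq> 0" "odd_proj y a \<noteq> 0"
      by (rule not_good_axisE)
    have t: "\<tau> a = (1 - l, 1 - l)" "\<tau> y = (l, l)" using \<tau>_eq ly by blast+
    \<comment> \<open>Otherwise \<open>c\<close> is the type \<open>1 - l\<close> of
      \<open>a\<close>, which would then be preferred.\<close>
    have "l = 2"
    proof (rule ccontr)
      assume "l \<noteq> 2"
      moreover have "l = 2" if "1 - l = - 1" using that by algebra
      ultimately have "c = 1 - l" by (auto simp: c_def t)
      moreover have "1 - l \<noteq> 1 - (1 - l)" using ly(1,2) by (metis diff_diff_eq2 add_diff_cancel_left')
      ultimately show False using P(3) ly(2) by simp
    qed
    hence t': "\<tau> a = (-1, -1)" "\<tau> y = (2, 2)" "primitive_axis (- 1) (- 1) a" "primitive_axis 2 2 y"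
      using t ly by simp_all
    have "(2::'f) \<noteq> - 1"
    proof
      assume "(2::'f) = - 1"
      hence "1 - l = l" using \<open>l = 2\<close> by simp
      thus False using ly(1,2) by metis
    qed
    hence rad: "a \<in> form_radical B" if "frobenius_form B" for B
      using axis_in_radical[OF t'(3,4) ly(5)] that by blast
    have "a \<star> y \<noteq> 0"
    proof
      assume "a \<star> y = 0"
      hence "phi a y *s a + (- 1) *s odd_proj a y = 0" using axis_mult(1)[OF t'(3), of y] by simp
      hence "odd_proj a (phi a y *s a + (- 1) *s odd_proj a y) = 0" using aP by (simp add: peirce_zero)
      thus False using aP ly(5) by (simp add: peirce_simps)
    qed
    thus ?thesis using N t' rad primitive_axesI[OF t'(4)] by blast
  qed
qed

end

theorem theoremF:
  fixes scale :: "'f::field \<Rightarrow> 'a::ab_group_add \<Rightarrow> 'a"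
    and mult :: "'a \<Rightarrow> 'a \<Rightarrow> 'a"
    and \<tau> :: "'a \<Rightarrow> 'f \<times> 'f"
    and X :: "'a set" and a :: 'a
  assumes "nonassoc_algebra scale mult"
    and "(2::'f) \<noteq> 0"
    and "nonassoc_algebra.type_function scale mult \<tau>"
    and "X \<subseteq> nonassoc_algebra.primitive_axes scale mult"
    and "nonassoc_algebra.generates scale mult X"
    and "a \<in> X"
  shows "(\<exists>X' B. nonassoc_algebra.normalised_axes scale mult X' B) \<and>
    ((\<exists>X' B. nonassoc_algebra.normalised_axes scale mult X' B \<and> a \<in> X') \<or>
     (\<tau> a = (-1, -1) \<and>
      (\<exists>b \<in> nonassoc_algebra.primitive_axes scale mult. \<tau> b = (2, 2) \<and> mult a b \<noteq> 0) \<and>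
      (\<forall>B. nonassoc_algebra.frobenius_form scale mult B \<longrightarrow> a \<in> form_radical B)))"
proof -
  interpret nonassoc_algebra_char_not_2 scale mult
    using assms(1,2) by (simp add: nonassoc_algebra_char_not_2_def nonassoc_algebra_char_not_2_axioms_def)
  show ?thesis using normalised_axes_or_radical[OF assms(3-6)] .
qed

end
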